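(* Let $k\ge2$ be an integer, $a>1$, and let $B_0$, $B_1$, $B_2$ be finite Blaschke products with $$\deg B_0=k-1,\quad\deg B_1=k,\quad\deg B_2=k-2.$$ Suppose that $t_1,\dots,t_d$ are distinct points in $(0,1)$, that $\Delta_1,\dots,\Delta_d$ is a partition (into nonempty sets) of the zero set of $B_0$, and that $\varkappa_j$ is the number of zeros of $B_0$ in $\Delta_j$ (counted with multiplicities). Assume that for each $1\le j\le d$ the function $$1-t_ja^2B_1B_2$$ vanishes at the points of $\Delta_j$ (counted with their multiplicities as zeros of $B_0$). Define $$\Psi_{[t]}=\begin{pmatrix}\frac1{B_0}&a\\-a&B_0\end{pmatrix}\begin{pmatrix}\frac{B_0}{B_1}&0\\0&t\frac{B_2}{B_0}\end{pmatrix}\begin{pmatrix}\frac1{B_0}&a\\-a&B_0\end{pmatrix},\quad 0<t\le1.$$ Then, for $t\in(0,1]$, the inequality $$\deg\mathbb P_+\Psi_{[t]}\le\deg\mathbb P_-\Psi_{[t]}-2$$ is violated precisely for $t=t_1,\dots,t_d$, and $$\deg\mathbb P_+\Psi_{[t_j]}=\deg\mathbb P_-\Psi_{[t_j]}-2+\varkappa_j,\quad 1\le j\le d.$$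
   Context: $\mathbb D$ is the open unit disk, $\mathbb T$ the unit circle, $\hat{\mathbb C}$ the Riemann sphere. A finite Blaschke product of degree $d$ is a function $c\prod_{j=1}^d\frac{\lambda_j-z}{1-\bar\lambda_jz}$ with $|c|=1$, $\lambda_j\in\mathbb D$. For a matrix function $\Phi$ on $\mathbb T$ with Fourier coefficients $\hat\Phi(j)$, $(\mathbb P_+\Phi)(z)=\sum_{j\ge0}\hat\Phi(j)z^j$ and $\mathbb P_-\Phi=\Phi-\mathbb P_+\Phi$. McMillan degree: a finite Blaschke–Potapov product of size $n\times n$ is $B=UB_1\cdots B_k$ with $U$ a constant unitary matrix and $B_j(z)=\frac{\lambda_j-z}{1-\bar\lambda_jz}P_j+(I-P_j)$, $\lambda_j\in\mathbb D$, $P_j$ orthogonal projections on $\mathbb C^n$; $\deg B=\sum_j\operatorname{rank}P_j$. If all poles (in $\hat{\mathbb C}$) of a rational $m\times n$ matrix function $\Phi$ lie in $\mathbb D$, $\deg\Phi$ is the smallest degree of an $n\times n$ finite Blaschke–Potapov product $B$ such that $\Phi B$ is bounded and analytic in $\mathbb D$ (constants have degree $0$). If $\Phi$ has no poles in the closed unit disk, $\deg\Phi=\deg\Phi_\flat$ with $\Phi_\flat(z)=\Phi(1/z)$. *)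

theory Defs
  imports "HOL-Complex_Analysis.Complex_Analysis" "HOL-Computational_Algebra.Computational_Algebra"
begin

text \<open>
  Functions on the Riemann sphere are modelled as functions on \<^typ>\<open>complex\<close>; by
  \<open>x / 0 = 0\<close> they take a meaningless value at a pole, and also at a removable singularity of
  the formula defining them. The McMillan degree
  and the projections below do not depend on these finitely many values.
\<close>

definition blaschke_factor :: "complex \<Rightarrow> complex \<Rightarrow> complex" where
  "blaschke_factor \<mu> z = (\<mu> - z) / (1 - cnj \<mu> * z)"

definition finite_blaschke_product :: "nat \<Rightarrow> (complex \<Rightarrow> complex) \<Rightarrow> bool" where
  "finite_blaschke_product d f \<longleftrightarrow>
     (\<exists>c \<mu>. cmod c = 1 \<and> (\<forall>j\<in>{1..d}. \<mu> j \<in> ball 0 1) \<and>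
            f = (\<lambda>z. c * (\<Prod>j=1..d. blaschke_factor (\<mu> j) z)))"

text \<open>All zeros of a finite Blaschke product lie in the unit disk. The restriction to the disk
  is needed because \<open>x / 0 = 0\<close> makes the product vanish at its poles as well.\<close>

definition disk_zeros :: "(complex \<Rightarrow> complex) \<Rightarrow> complex set" where
  "disk_zeros f = {z \<in> ball 0 1. f z = 0}"

definition conj_transpose :: "complex^'n^'m \<Rightarrow> complex^'m^'n" where
  "conj_transpose A = (\<chi> i j. cnj (A $ j $ i))"

definition unitary_matrix :: "complex^'n^'n \<Rightarrow> bool" where
  "unitary_matrix U \<longleftrightarrow> conj_transpose U ** U = mat 1 \<and> U ** conj_transpose U = mat 1"

definition orth_projection :: "complex^'n^'n \<Rightarrow> bool" where
  "orth_projection P \<longleftrightarrow> P ** P = P \<and> conj_transpose P = P"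

definition potapov_factor :: "complex \<Rightarrow> complex^'n^'n \<Rightarrow> complex \<Rightarrow> complex^'n^'n" where
  "potapov_factor \<mu> P z = (\<chi> i j. blaschke_factor \<mu> z * P $ i $ j) + (mat 1 - P)"

text \<open>\<open>blaschke_potapov B d\<close> says that \<open>B\<close> has a representation \<open>U B\<^sub>1 \<dots> B\<^sub>k\<close> whose projections
  have total rank \<open>d\<close>.\<close>

inductive blaschke_potapov :: "(complex \<Rightarrow> complex^'n^'n) \<Rightarrow> nat \<Rightarrow> bool" where
  unitary: "unitary_matrix U \<Longrightarrow> blaschke_potapov (\<lambda>z. U) 0"
| factor: "blaschke_potapov B d \<Longrightarrow> \<mu> \<in> ball 0 1 \<Longrightarrow> orth_projection P \<Longrightarrow>
             blaschke_potapov (\<lambda>z. B z ** potapov_factor \<mu> P z) (d + rank P)"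

definition has_pole :: "(complex \<Rightarrow> complex^'n^'m) \<Rightarrow> complex \<Rightarrow> bool" where
  "has_pole \<Phi> z \<longleftrightarrow> (\<exists>i j. is_pole (\<lambda>w. \<Phi> w $ i $ j) z)"

definition flat :: "(complex \<Rightarrow> complex^'n^'m) \<Rightarrow> complex \<Rightarrow> complex^'n^'m" where
  "flat \<Phi> z = \<Phi> (1 / z)"

definition has_pole_at_infinity :: "(complex \<Rightarrow> complex^'n^'m) \<Rightarrow> bool" where
  "has_pole_at_infinity \<Phi> \<longleftrightarrow> has_pole (flat \<Phi>) 0"

text \<open>Bounded and analytic in the unit disk, after removal of removable singularities
  (\<^const>\<open>remove_sings\<close> is not continuous at a pole, so poles are excluded).\<close>

definition bounded_analytic_disk :: "(complex \<Rightarrow> complex^'n^'m) \<Rightarrow> bool" where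
  "bounded_analytic_disk F \<longleftrightarrow>
     (\<forall>i j. remove_sings (\<lambda>z. F z $ i $ j) analytic_on ball 0 1 \<and>
            bounded (remove_sings (\<lambda>z. F z $ i $ j) ` ball 0 1))"

definition inner_degree :: "(complex \<Rightarrow> complex^'n^'m) \<Rightarrow> nat" where
  "inner_degree \<Phi> = (LEAST d. \<exists>B :: complex \<Rightarrow> complex^'n^'n.
     blaschke_potapov B d \<and> bounded_analytic_disk (\<lambda>z. \<Phi> z ** B z))"

text \<open>Only meaningful for rational \<open>\<Phi>\<close> satisfying one of the two pole conditions; only
  constants satisfy both, and then both branches give \<open>0\<close>.\<close>

definition mcmillan_degree :: "(complex \<Rightarrow> complex^'n^'m) \<Rightarrow> nat" where
  "mcmillan_degree \<Phi> =
     (if (\<forall>z. has_pole \<Phi> z \<longrightarrow> z \<in> ball 0 1) \<and> \<not> has_pole_at_infinity \<Phi> then inner_degree \<Phi>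
      else if \<forall>z\<in>cball 0 1. \<not> has_pole \<Phi> z then inner_degree (flat \<Phi>)
      else undefined)"

text \<open>Since \<open>p\<close> and \<open>q\<close> are coprime, the value at a pole is \<open>0\<close>, so that a rational function has
  exactly one representative, and that is determined by its values on the unit circle.\<close>

definition rational_function :: "(complex \<Rightarrow> complex) \<Rightarrow> bool" where
  "rational_function f \<longleftrightarrow> (\<exists>p q. q \<noteq> 0 \<and> coprime p q \<and> f = (\<lambda>z. poly p z / poly q z))"

definition rational_matrix :: "(complex \<Rightarrow> complex^'n^'m) \<Rightarrow> bool" where
  "rational_matrix \<Phi> \<longleftrightarrow> (\<forall>i j. rational_function (\<lambda>z. \<Phi> z $ i $ j))"

definition rational_extension :: "(complex \<Rightarrow> complex^'n^'m) \<Rightarrow> complex \<Rightarrow> complex^'n^'m" where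
  "rational_extension F = (THE R. rational_matrix R \<and> (\<forall>z\<in>sphere 0 1. R z = F z))"

lemma rational_function_unique:
  assumes "rational_function f" "rational_function g" "\<And>z. z \<in> sphere 0 1 \<Longrightarrow> f z = g z"
  shows "f = g"
proof -
  obtain p q where pq: "q \<noteq> 0" "coprime p q" "f = (\<lambda>z. poly p z / poly q z)"
    using assms(1) by (auto simp: rational_function_def)
  obtain r s where rs: "s \<noteq> 0" "coprime r s" "g = (\<lambda>z. poly r z / poly s z)"
    using assms(2) by (auto simp: rational_function_def)
  have inf: "infinite (sphere (0::complex) 1)"
  proof -
    have "connected (sphere (0::complex) 1)"
      by (rule connected_sphere) simp
    hence "uncountable (sphere (0::complex) 1)"
      by (rule connected_uncountable[of _ 1 "-1"]) simp_all
    thus ?thesis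
      by (rule uncountable_infinite)
  qed
  have fin: "finite {z. poly (q * s) z = 0}"
    using pq rs by (intro poly_roots_finite) auto
  have "sphere 0 1 - {z. poly (q * s) z = 0} \<subseteq> {z. poly (p * s - r * q) z = 0}"
  proof
    fix z :: complex assume z: "z \<in> sphere 0 1 - {z. poly (q * s) z = 0}"
    hence "poly p z / poly q z = poly r z / poly s z"
      using assms(3)[of z] by (simp add: pq(3) rs(3))
    thus "z \<in> {z. poly (p * s - r * q) z = 0}"
      using z by (simp add: frac_eq_eq)
  qed
  moreover have "infinite (sphere 0 1 - {z. poly (q * s) z = 0})"
    using inf fin by (rule Diff_infinite_finite[rotated])
  ultimately have "infinite {z. poly (p * s - r * q) z = 0}"
    using finite_subset by blast
  hence "p * s - r * q = 0"
    using poly_roots_finite[of "p * s - r * q"] by argo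
  hence eq: "p * s = r * q"
    by simp
  have pt: "poly p z * poly s z = poly r z * poly q z" for z
    using arg_cong[OF eq, of "\<lambda>x. poly x z"] by simp
  have zeros: "poly q z = 0 \<longleftrightarrow> poly s z = 0" for z
    using pt[of z] coprime_poly_0[OF pq(2), of z] coprime_poly_0[OF rs(2), of z]
    by (metis mult_eq_0_iff)
  show ?thesis
  proof
    fix z
    show "f z = g z"
      using zeros[of z] pt[of z]
      by (cases "poly s z = 0") (simp_all add: pq(3) rs(3) frac_eq_eq)
  qed
qed

lemma rational_extension_eqI:
  assumes "rational_matrix R" "\<And>z. z \<in> sphere 0 1 \<Longrightarrow> R z = F z"
  shows "rational_extension F = R"
  unfolding rational_extension_def
proof (rule the_equality)
  fix S assume S: "rational_matrix S \<and> (\<forall>z\<in>sphere 0 1. S z = F z)"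
  have "(\<lambda>z. S z $ i $ j) = (\<lambda>z. R z $ i $ j)" for i j
    using S assms by (intro rational_function_unique) (auto simp: rational_matrix_def)
  thus "S = R" by (auto simp: fun_eq_iff vec_eq_iff)
qed (use assms in auto)

definition fourier_coeff :: "(complex \<Rightarrow> complex) \<Rightarrow> int \<Rightarrow> complex" where
  "fourier_coeff f k = integral {0..2*pi} (\<lambda>\<theta>. f (cis \<theta>) * cis (- of_int k * \<theta>)) / (2 * pi)"

definition riesz_plus :: "(complex \<Rightarrow> complex^'n^'m) \<Rightarrow> complex \<Rightarrow> complex^'n^'m" where
  "riesz_plus \<Phi> z = (\<chi> i j. \<Sum>n. fourier_coeff (\<lambda>w. \<Phi> w $ i $ j) (int n) * z ^ n)"

definition riesz_minus :: "(complex \<Rightarrow> complex^'n^'m) \<Rightarrow> complex \<Rightarrow> complex^'n^'m" where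
  "riesz_minus \<Phi> z = \<Phi> z - riesz_plus \<Phi> z"

text \<open>The projections are functions on the unit circle; their McMillan degrees are those of
  the rational functions having these boundary values.\<close>

definition deg_plus :: "(complex \<Rightarrow> complex^'n^'m) \<Rightarrow> nat" where
  "deg_plus \<Phi> = mcmillan_degree (rational_extension (riesz_plus \<Phi>))"

definition deg_minus :: "(complex \<Rightarrow> complex^'n^'m) \<Rightarrow> nat" where
  "deg_minus \<Phi> = mcmillan_degree (rational_extension (riesz_minus \<Phi>))"

definition Psi :: "(complex \<Rightarrow> complex) \<Rightarrow> (complex \<Rightarrow> complex) \<Rightarrow> (complex \<Rightarrow> complex) \<Rightarrow>
    real \<Rightarrow> real \<Rightarrow> complex \<Rightarrow> complex^2^2" where
  "Psi B0 B1 B2 a t z =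
     (let W = vector [vector [1 / B0 z, of_real a], vector [- of_real a, B0 z]] :: complex^2^2;
          D = vector [vector [B0 z / B1 z, 0], vector [0, of_real t * (B2 z / B0 z)]] :: complex^2^2
      in W ** D ** W)"

end

theory Submission
  imports Defs "HOL-Computational_Algebra.Field_as_Ring"
begin

text \<open>
  Multiplied out, \<open>\<Psi>\<close> has the entries \<open>(1 - t a\<^sup>2 B\<^sub>1 B\<^sub>2) / (B\<^sub>0 B\<^sub>1)\<close>, \<open>\<plusminus> a (1 / B\<^sub>1 + t B\<^sub>2)\<close> and
  \<open>B\<^sub>0 (- a\<^sup>2 / B\<^sub>1 + t B\<^sub>2)\<close>, and its determinant is \<open>t (1 + a\<^sup>2)\<^sup>2 B\<^sub>2 / B\<^sub>1\<close>. The antianalytic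
  projection carries the poles of \<open>\<Psi>\<close> in the disk and the analytic projection those outside, so
  both degrees count poles of \<open>\<Psi>\<close>.

  The count rests on one principle (\<open>inner_degree_eq_size_mod_analytic\<close>). Suppose that \<open>\<Phi> = M / q\<close>
  up to a matrix analytic on the closed disk, where \<open>q\<close> is a scalar Blaschke product with \<open>N\<close> zeros,
  that one entry of \<open>M\<close> vanishes at no zero of \<open>q\<close>, and that \<open>q\<close> divides \<open>det M\<close>. Then the degree is \<open>N\<close>.
  On the one hand, if \<open>\<Phi> B\<close> is analytic, multiplication by the adjugate of \<open>B\<close> shows that \<open>q\<close> divides
  the good entry times \<open>det B\<close>, hence \<open>det B\<close>, which is a Blaschke product whose degree is the
  degree of \<open>B\<close>. On the other hand, rank one factors can be peeled off the row of the good
  entry one zero at a time until \<open>q\<close> divides this row times \<open>B\<close>; the other row is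
  proportional to it modulo \<open>q\<close>, because \<open>det M\<close> vanishes there.

  In the disk the entry \<open>(1,1)\<close> is the good one. Its denominator has degree \<open>2 k - 1\<close>, and
  a zero of \<open>B\<^sub>0\<close> cancels only if \<open>t a\<^sup>2 B\<^sub>1 B\<^sub>2 = 1\<close> there. Every zero of \<open>B\<^sub>0\<close> lies in some \<open>\<Delta>\<^sub>j\<close>, where
  this says \<open>t = t\<^sub>j\<close>; and for \<open>t = t\<^sub>j\<close> all of \<open>\<Delta>\<^sub>j\<close> cancels with full multiplicity. So the degree is
  \<open>2 k - 1\<close>, lowered by \<open>\<kappa>\<^sub>j\<close> at \<open>t = t\<^sub>j\<close>.

  For the poles outside, \<open>z \<mapsto> 1 / z\<close> turns \<open>B\<^sub>i\<close> into \<open>c\<^sub>i / x\<^sub>i\<close>, where \<open>x\<^sub>i\<close> is the Blaschke product with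
  the conjugate zeros. Now the entry \<open>(2,2)\<close> is the good one, with \<open>q = x\<^sub>0 x\<^sub>2\<close> of degree \<open>2 k - 3\<close>.
  Since \<open>t\<^sub>j a\<^sup>2 B\<^sub>1 B\<^sub>2 = 1\<close> on \<open>\<Delta>\<^sub>j\<close>, a cancellation at a zero of \<open>x\<^sub>0\<close> would give \<open>t t\<^sub>j = 1\<close> on taking
  moduli, which is impossible. So this degree is \<open>2 k - 3\<close> for every \<open>t\<close>.
\<close>

(* Both power series coefficients and matrix entries are written with a dollar sign; only the
   latter are meant below. *)
no_notation fps_nth (infixl "$" 75)

section \<open>Idempotent matrices of size two\<close>

text \<open>
  Cayley--Hamilton with \<open>det P = 0\<close> reads \<open>P\<^sup>2 = (tr P) P\<close>, so an idempotent \<open>P\<close> that is neither zero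
  nor the identity has trace one.
\<close>

lemma idempotent_cases_2:
  fixes P :: "complex^2^2"
  assumes "P ** P = P"
  shows "P = 0 \<or> P = mat 1 \<or> (det P = 0 \<and> P$1$1 + P$2$2 = 1)"
proof -
  have e: "P$1$1 * P$1$1 + P$1$2 * P$2$1 = P$1$1" "P$1$1 * P$1$2 + P$1$2 * P$2$2 = P$1$2"
    "P$2$1 * P$1$1 + P$2$2 * P$2$1 = P$2$1" "P$2$1 * P$1$2 + P$2$2 * P$2$2 = P$2$2"
    using assms by (auto simp: vec_eq_iff forall_2 matrix_matrix_mult_def sum_2)
  have "det P = 0 \<or> P = mat 1"
  proof (cases "det P = 0")
    case False
    then obtain Q where "Q ** P = mat 1" using invertible_det_nz[of P] invertible_def by blast
    then have "P = mat 1" using assms by (metis matrix_mul_assoc matrix_mul_lid)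
    thus ?thesis by simp
  qed simp
  moreover have "P = 0 \<or> P$1$1 + P$2$2 = 1" if d: "det P = 0"
  proof (rule disjCI)
    assume t: "P$1$1 + P$2$2 \<noteq> 1"
    have d': "P$1$1 * P$2$2 = P$1$2 * P$2$1" using d by (simp add: det_2)
    have "P$1$1 * (P$1$1 + P$2$2 - 1) = 0" "P$1$2 * (P$1$1 + P$2$2 - 1) = 0"
       "P$2$1 * (P$1$1 + P$2$2 - 1) = 0" "P$2$2 * (P$1$1 + P$2$2 - 1) = 0"
      using e d' by (simp_all add: algebra_simps)
    thus "P = 0" using t by (simp add: vec_eq_iff forall_2)
  qed
  ultimately show ?thesis by blast
qed

lemma rank_zero_complex: "rank (0 :: complex^2^2) = 0"
  by (auto simp: row_rank_def_gen rows_def row_def zero_vec_def[symmetric] vec.dim_eq_0)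

lemma rank_mat1_complex: "rank (mat 1 :: complex^2^2) = 2"
proof -
  have "vec.span (rows (mat 1 :: complex^2^2)) = UNIV"
    using matrix_left_invertible_span_rows_gen[of "mat 1 :: complex^2^2"] matrix_mul_lid by blast
  hence "vec.dim (rows (mat 1 :: complex^2^2)) = vec.dim (UNIV :: (complex^2) set)"
    by (metis vec.dim_span)
  also have "\<dots> = CARD(2)" by (rule vec_dim_card)
  finally show ?thesis by (simp add: row_rank_def_gen)
qed

lemma rank_eq_1_complex:
  fixes P :: "complex^2^2"
  assumes "P \<noteq> 0" "det P = 0"
  shows "rank P = 1"
proof -
  have "rows P = (\<lambda>i. P$i) ` UNIV"
    by (auto simp: rows_def row_def vec_lambda_eta)
  hence rows: "rows P = {P$1, P$2}" by (simp add: UNIV_2)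
  have d: "P$1$1 * P$2$2 = P$1$2 * P$2$1" using assms(2) by (simp add: det_2)
  have "\<exists>v. v \<noteq> 0 \<and> vec.span {P$1, P$2} = vec.span {v}"
  proof (cases "P$1 = 0")
    case True
    have "P$2 \<noteq> 0"
    proof
      assume "P$2 = 0"
      hence "P = 0" using True unfolding vec_eq_iff[of P] forall_2 by simp
      thus False using assms(1) by simp
    qed
    moreover have "vec.span {P$1, P$2} = vec.span {P$2}" by (simp only: True vec.span_insert_0)
    ultimately show ?thesis by blast
  next
    case False
    have "\<exists>c. P$2 = c *s P$1"
    proof (cases "P$1$1 = 0")
      case True
      hence n: "P$1$2 \<noteq> 0" using False by (simp add: vec_eq_iff forall_2)
      have "P$2$1 = 0" using d True n by simp
      hence "P$2 = (P$2$2 / P$1$2) *s P$1"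
        unfolding vec_eq_iff[of "P$2"] forall_2 vector_smult_component using n True by simp
      thus ?thesis by blast
    next
      case n: False
      hence "P$2$2 = P$2$1 / P$1$1 * P$1$2" using d by (simp add: field_simps)
      hence "P$2 = (P$2$1 / P$1$1) *s P$1"
        unfolding vec_eq_iff[of "P$2"] forall_2 vector_smult_component using n by simp
      thus ?thesis by blast
    qed
    then obtain c where "P$2 = c *s P$1" ..
    hence "P$2 \<in> vec.span {P$1}" by (simp only: vec.span_scale vec.span_base singletonI)
    hence "vec.span {P$2, P$1} = vec.span {P$1}" by (rule vec.span_redundant)
    hence "vec.span {P$1, P$2} = vec.span {P$1}" by (simp only: insert_commute)
    thus ?thesis using False by blast
  qed
  then obtain v where v: "v \<noteq> 0" "vec.span {P$1, P$2} = vec.span {v}" by blast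
  have "vec.dim {P$1,P$2} = vec.dim {v}" using v(2) by (metis vec.dim_span)
  also have "\<dots> = 1" using v(1) by (simp add: vec.dim_eq_card_independent)
  finally show ?thesis by (simp add: row_rank_def_gen rows)
qed

text \<open>
  On the range of \<open>P\<close> the factor acts as the scalar Blaschke factor, on its kernel as the
  identity. This is what makes the degree of a Blaschke--Potapov product visible in its determinant.
\<close>

lemma det_potapov_factor:
  fixes P :: "complex^2^2"
  assumes "P ** P = P"
  shows "det (potapov_factor \<mu> P z) = blaschke_factor \<mu> z ^ rank P"
proof -
  let ?b = "blaschke_factor \<mu> z"
  have D: "det (potapov_factor \<mu> P z) = 1 + (?b - 1) * (P$1$1 + P$2$2) + (?b - 1)^2 * det P"
    by (simp add: det_2 potapov_factor_def mat_def power2_eq_square algebra_simps)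
  from idempotent_cases_2[OF assms] show ?thesis
  proof (elim disjE)
    assume "P = 0" thus ?thesis using D by (simp add: rank_zero_complex det_2)
  next
    assume "P = mat 1" thus ?thesis using D
        by (simp add: rank_mat1_complex power2_eq_square algebra_simps, simp add: mat_def algebra_simps)
  next
    assume p: "det P = 0 \<and> P$1$1 + P$2$2 = 1"
    hence "P \<noteq> 0" by auto
    thus ?thesis using D p by (simp add: rank_eq_1_complex)
  qed
qed

section \<open>Scalar Blaschke products\<close>

text \<open>
  The zeros are a multiset, so that cancelling a zero, splitting the zeros by a predicate and
  counting multiplicities are multiset operations.
\<close>

definition blaschke_prod :: "complex multiset \<Rightarrow> complex \<Rightarrow> complex" where
  "blaschke_prod L z = (\<Prod>\<mu>\<in>#L. blaschke_factor \<mu> z)"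

lemma blaschke_prod_empty [simp]: "blaschke_prod {#} z = 1"
  by (simp add: blaschke_prod_def)

lemma blaschke_prod_add_mset [simp]:
  "blaschke_prod (add_mset \<mu> L) z = blaschke_factor \<mu> z * blaschke_prod L z"
  by (simp add: blaschke_prod_def)

lemma blaschke_prod_union [simp]:
  "blaschke_prod (L + M) z = blaschke_prod L z * blaschke_prod M z"
  by (simp add: blaschke_prod_def)

lemma blaschke_factor_denom_nonzero:
  assumes "\<mu> \<in> ball 0 1" "z \<in> cball 0 1"
  shows "1 - cnj \<mu> * z \<noteq> 0"
proof
  assume "1 - cnj \<mu> * z = 0"
  hence "cmod \<mu> * cmod z = 1" by (metis complex_mod_cnj eq_iff_diff_eq_0 norm_mult norm_one)
  moreover have "cmod \<mu> * cmod z \<le> cmod \<mu> * 1" using assms by (intro mult_left_mono) auto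
  ultimately show False using assms by auto
qed

lemma blaschke_factor_zero_iff:
  assumes "\<mu> \<in> ball 0 1" "z \<in> cball 0 1"
  shows "blaschke_factor \<mu> z = 0 \<longleftrightarrow> z = \<mu>"
  using blaschke_factor_denom_nonzero[OF assms] by (auto simp: blaschke_factor_def)

lemma blaschke_prod_zero_iff:
  assumes "set_mset L \<subseteq> ball 0 1" "z \<in> cball 0 1"
  shows "blaschke_prod L z = 0 \<longleftrightarrow> z \<in># L"
  using assms by (induction L) (auto simp: blaschke_factor_zero_iff)

lemma blaschke_factor_analytic:
  assumes "\<mu> \<in> ball 0 1"
  shows "blaschke_factor \<mu> analytic_on cball 0 1"
proof -
  have "(\<lambda>z. (\<mu> - z) / (1 - cnj \<mu> * z)) analytic_on cball 0 1"
    using blaschke_factor_denom_nonzero[OF assms] by (intro analytic_intros) auto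
  thus ?thesis by (simp add: blaschke_factor_def[abs_def])
qed

lemma blaschke_prod_analytic:
  assumes "set_mset L \<subseteq> ball 0 1"
  shows "blaschke_prod L analytic_on cball 0 1"
  using assms
proof (induction L)
  case empty thus ?case by (simp add: blaschke_prod_def[abs_def] analytic_on_const)
next
  case (add x L)
  have "(\<lambda>z. blaschke_factor x z * blaschke_prod L z) analytic_on cball 0 1"
    using add by (intro analytic_on_mult blaschke_factor_analytic) auto
  thus ?case by (simp only: blaschke_prod_add_mset[abs_def])
qed

text \<open>
  The range allowed for \<open>S\<close> covers both the open disk, where analyticity of \<open>\<Phi> B\<close> is
  given, and the closed disk, where it also yields boundedness.
\<close>

lemma divide_by_blaschke_factor:
  assumes f: "f analytic_on S" and S: "ball 0 1 \<subseteq> S" "S \<subseteq> cball 0 1"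
    and \<mu>: "\<mu> \<in> ball 0 1" "f \<mu> = 0"
  obtains g where "g analytic_on S" "\<And>z. z \<in> S \<Longrightarrow> f z = blaschke_factor \<mu> z * g z"
proof -
  obtain T where T: "open T" "S \<subseteq> T" "f holomorphic_on T"
    using f by (auto simp: analytic_on_holomorphic)
  define h where "h z = (if z = \<mu> then deriv f \<mu> else (f z - f \<mu>) / (z - \<mu>))" for z
  have "h holomorphic_on T" unfolding h_def using T by (intro pole_lemma_open) auto
  hence h: "h analytic_on S" using T analytic_on_holomorphic by blast
  have fh: "f z = (z - \<mu>) * h z" for z using \<mu>(2) by (simp add: h_def)
  have "(\<lambda>z. - (1 - cnj \<mu> * z) * h z) analytic_on S"
    by (intro analytic_intros h)
  moreover have "f z = blaschke_factor \<mu> z * (- (1 - cnj \<mu> * z) * h z)" if "z \<in> S" for z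
  proof -
    have "1 - cnj \<mu> * z \<noteq> 0" using blaschke_factor_denom_nonzero[OF \<mu>(1)] that S by blast
    hence "blaschke_factor \<mu> z * (1 - cnj \<mu> * z) = \<mu> - z" by (simp add: blaschke_factor_def)
    thus ?thesis unfolding fh by (metis minus_diff_eq minus_mult_left minus_mult_commute mult.assoc)
  qed
  ultimately show thesis using that by blast
qed

text \<open>
  Identities obtained by dividing hold off finitely many points; continuity fills these in.
\<close>

lemma analytic_eq_at_point:
  assumes "f analytic_on {\<mu>}" "g analytic_on {\<mu>}" "\<forall>\<^sub>F z in at \<mu>. f z = g z"
  shows "f \<mu> = g \<mu>"
proof -
  have "f \<midarrow>\<mu>\<rightarrow> f \<mu>" "g \<midarrow>\<mu>\<rightarrow> g \<mu>"
    using assms(1,2) analytic_at_imp_isCont isContD by blast+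
  moreover have "g \<midarrow>\<mu>\<rightarrow> f \<mu>" using calculation(1) assms(3) by (rule Lim_transform_eventually)
  ultimately show ?thesis using LIM_unique by blast
qed

lemma blaschke_factor_cancel:
  assumes f: "f analytic_on S" and g: "g analytic_on S" and S: "ball 0 1 \<subseteq> S" "S \<subseteq> cball 0 1"
    and \<mu>: "\<mu> \<in> ball 0 1"
    and eq: "\<And>z. z \<in> S \<Longrightarrow> blaschke_factor \<mu> z * f z = blaschke_factor \<mu> z * g z"
    and z: "z \<in> S"
  shows "f z = g z"
proof (cases "z = \<mu>")
  case False
  thus ?thesis using eq[OF z] blaschke_factor_zero_iff[OF \<mu>, of z] z S by auto
next
  case True
  have "\<forall>\<^sub>F w in at \<mu>. w \<in> ball 0 1 - {\<mu>}"
    using \<mu> by (intro eventually_at_in_open) auto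
  hence "\<forall>\<^sub>F w in at \<mu>. f w = g w"
    by eventually_elim (use eq blaschke_factor_zero_iff[OF \<mu>] S in fastforce)
  moreover have "f analytic_on {\<mu>}" "g analytic_on {\<mu>}"
    using f g True z by (auto intro: analytic_on_subset)
  ultimately show ?thesis using True analytic_eq_at_point by blast
qed

text \<open>
  Euclid's lemma for a product of linear factors: a factor vanishing where \<open>m\<close> does not
  must divide \<open>x\<close>.
\<close>

lemma blaschke_prod_dvd_cancel:
  assumes "set_mset L \<subseteq> ball 0 1" and S: "ball 0 1 \<subseteq> S" "S \<subseteq> cball 0 1"
    and "m analytic_on S" "x analytic_on S" "g analytic_on S"
    and "\<And>\<mu>. \<mu> \<in># L \<Longrightarrow> m \<mu> \<noteq> 0"
    and "\<And>z. z \<in> S \<Longrightarrow> m z * x z = blaschke_prod L z * g z"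
  obtains h where "h analytic_on S" "\<And>z. z \<in> S \<Longrightarrow> x z = blaschke_prod L z * h z"
  using assms(1,4-)
proof (induction L arbitrary: x thesis)
  case empty
  show ?case by (rule empty(1)[of x]) (use empty in auto)
next
  case (add \<mu> L)
  have \<mu>: "\<mu> \<in> ball 0 1" "\<mu> \<in> S" using add.prems S by auto
  have "m \<mu> * x \<mu> = 0" using add.prems(7)[of \<mu>] \<mu>
    by (simp add: blaschke_factor_def)
  hence "x \<mu> = 0" using add.prems(6)[of \<mu>] by auto
  then obtain y where y: "y analytic_on S" "\<And>z. z \<in> S \<Longrightarrow> x z = blaschke_factor \<mu> z * y z"
    using divide_by_blaschke_factor[OF add.prems(4) S \<mu>(1)] by blast
  have bL: "blaschke_prod L analytic_on S"
    using blaschke_prod_analytic[of L] add.prems(2) S(2) analytic_on_subset by auto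
  have c: "m z * y z = blaschke_prod L z * g z" if "z \<in> S" for z
  proof (rule blaschke_factor_cancel[OF _ _ S \<mu>(1) _ that])
    show "(\<lambda>z. m z * y z) analytic_on S" "(\<lambda>z. blaschke_prod L z * g z) analytic_on S"
      using add.prems y bL by (auto intro!: analytic_on_mult)
    show "blaschke_factor \<mu> w * (m w * y w) = blaschke_factor \<mu> w * (blaschke_prod L w * g w)"
      if "w \<in> S" for w using add.prems(7)[OF that] y(2)[OF that] by (simp add: mult_ac)
  qed
  obtain h where h: "h analytic_on S" "\<And>z. z \<in> S \<Longrightarrow> y z = blaschke_prod L z * h z"
    using add.IH[of y] add.prems c y(1) by (metis set_mset_add_mset_insert subset_insertI subset_trans insertCI)
  show ?case by (rule add.prems(1)[OF h(1)]) (use h y in \<open>simp add: mult_ac\<close>)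
qed

text \<open>
  A Blaschke product that divides another one up to a cofactor without common zeros has no more
  zeros. This gives the lower bound for the degree.
\<close>

lemma size_le_of_blaschke_dvd:
  assumes "set_mset L \<subseteq> ball 0 1" "set_mset M \<subseteq> ball 0 1"
    and "m analytic_on ball 0 1" "g analytic_on ball 0 1"
    and "\<And>\<mu>. \<mu> \<in># L \<Longrightarrow> m \<mu> \<noteq> 0"
    and "\<And>z. z \<in> ball 0 1 \<Longrightarrow> blaschke_prod M z * m z = blaschke_prod L z * g z"
  shows "size L \<le> size M"
  using assms
proof (induction L arbitrary: M)
  case (add \<mu> L)
  have \<mu>: "\<mu> \<in> ball 0 1" using add.prems by auto
  have "blaschke_prod M \<mu> * m \<mu> = 0" using add.prems(6)[of \<mu>] \<mu>
    by (simp add: blaschke_factor_def)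
  hence "blaschke_prod M \<mu> = 0" using add.prems(5) by auto
  hence "\<mu> \<in># M" using blaschke_prod_zero_iff add.prems(2) \<mu> by auto
  then obtain N where N: "M = add_mset \<mu> N" by (metis insert_DiffM)
  have an: "blaschke_prod K analytic_on ball 0 1" if "set_mset K \<subseteq> ball 0 1" for K
    using blaschke_prod_analytic[OF that] analytic_on_subset ball_subset_cball by blast
  have "size L \<le> size N"
  proof (rule add.IH)
    show "blaschke_prod N z * m z = blaschke_prod L z * g z" if "z \<in> ball 0 1" for z
    proof (rule blaschke_factor_cancel[OF _ _ _ _ \<mu> _ that])
      show "(\<lambda>z. blaschke_prod N z * m z) analytic_on ball 0 1" "(\<lambda>z. blaschke_prod L z * g z) analytic_on ball 0 1"
        using add.prems N by (auto intro!: analytic_on_mult an)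
      show "blaschke_factor \<mu> w * (blaschke_prod N w * m w) = blaschke_factor \<mu> w * (blaschke_prod L w * g w)"
        if "w \<in> ball 0 1" for w using add.prems(6)[OF that] N by (simp add: mult_ac)
    qed auto
  qed (use add.prems N in auto)
  thus ?case using N by simp
qed auto

section \<open>Blaschke--Potapov products\<close>

text \<open>
  The determinant recovers the number \<open>d\<close>, which the definition attaches to a representation of
  \<open>B\<close> rather than to \<open>B\<close> itself.
\<close>

lemma det_blaschke_potapov:
  assumes "blaschke_potapov (B :: complex \<Rightarrow> complex^2^2) d"
  shows "\<exists>c M. c \<noteq> 0 \<and> size M = d \<and> set_mset M \<subseteq> ball 0 1 \<and> (\<forall>z. det (B z) = c * blaschke_prod M z)"
  using assms
proof (induction rule: blaschke_potapov.induct)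
  case (unitary U)
  have "det U \<noteq> 0" using unitary unfolding unitary_matrix_def
    by (metis invertible_def invertible_det_nz)
  thus ?case by (intro exI[of _ "det U"] exI[of _ "{#}"]) auto
next
  case (factor B d \<mu> P)
  then obtain c M where cM: "c \<noteq> 0" "size M = d" "set_mset M \<subseteq> ball 0 1" "\<And>z. det (B z) = c * blaschke_prod M z"
    by blast
  have r: "blaschke_prod (replicate_mset n \<mu>) z = blaschke_factor \<mu> z ^ n" for n z
    by (induction n) auto
  have "det (B z ** potapov_factor \<mu> P z) = c * blaschke_prod (M + replicate_mset (rank P) \<mu>) z" for z
    using factor by (simp add: det_mul cM(4) det_potapov_factor r orth_projection_def)
  moreover have "set_mset (M + replicate_mset (rank P) \<mu>) \<subseteq> ball 0 1"
    using cM(3) factor by (auto split: if_splits)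
  ultimately show ?case using cM(1,2) 
    by (intro exI[of _ c] exI[of _ "M + replicate_mset (rank P) \<mu>"]) auto
qed

lemma blaschke_potapov_analytic:
  assumes "blaschke_potapov (B :: complex \<Rightarrow> complex^'n^'n) d"
  shows "(\<lambda>z. B z $ i $ j) analytic_on cball 0 1"
  using assms
proof (induction arbitrary: i j rule: blaschke_potapov.induct)
  case (factor B d \<mu> P)
  have b: "blaschke_factor \<mu> analytic_on cball 0 1" by (rule blaschke_factor_analytic) fact
  have "(\<lambda>z. \<Sum>k\<in>UNIV. B z $ i $ k * (blaschke_factor \<mu> z * P $ k $ j + (mat 1 - P) $ k $ j)) analytic_on cball 0 1"
    by (intro analytic_on_sum analytic_on_mult analytic_on_add analytic_on_const factor.IH b)
  thus ?case by (simp add: matrix_matrix_mult_def potapov_factor_def)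
qed (simp add: analytic_on_const)

text \<open>
  The projection is the one onto the line spanned by the conjugate of \<open>v\<close>; it reproduces the
  row \<open>v\<close> when multiplied from the left. For \<open>v = 0\<close> any line will do, and taking one keeps the
  rank equal to one.
\<close>

lemma exists_rank_one_projection:
  fixes v :: "2 \<Rightarrow> complex"
  shows "\<exists>P :: complex^2^2. orth_projection P \<and> rank P = 1 \<and> (\<forall>j. (\<Sum>k\<in>UNIV. v k * (mat 1 - P) $ k $ j) = 0)"
proof (cases "v = (\<lambda>_. 0)")
  case True
  define P :: "complex^2^2" where "P = (\<chi> i j. if i = 1 \<and> j = 1 then 1 else 0)"
  have p: "P$1$1 = 1" "P$1$2 = 0" "P$2$1 = 0" "P$2$2 = 0" by (simp_all add: P_def)
  have "orth_projection P" unfolding orth_projection_def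
    by (simp add: vec_eq_iff forall_2 matrix_matrix_mult_def sum_2 conj_transpose_def p)
  moreover have "rank P = 1"
  proof (rule rank_eq_1_complex)
    show "P \<noteq> 0" using p(1) by (metis zero_index zero_neq_one)
  qed (simp add: det_2 p)
  ultimately show ?thesis using True by auto
next
  case False
  define n where "n = v 1 * cnj (v 1) + v 2 * cnj (v 2)"
  have n: "n = of_real ((cmod (v 1))\<^sup>2 + (cmod (v 2))\<^sup>2)"
    unfolding n_def of_real_add complex_norm_square ..
  have "v 1 \<noteq> 0 \<or> v 2 \<noteq> 0" using False by (auto simp: fun_eq_iff) (metis exhaust_2)
  hence n0: "n \<noteq> 0" unfolding n of_real_eq_0_iff by (simp add: sum_power2_eq_zero_iff)
  have cn: "cnj n = n" by (simp add: n)
  define P :: "complex^2^2" where "P = (\<chi> i j. cnj (v i) * v j / n)"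
  have p: "P$i$j = cnj (v i) * v j / n" for i j by (simp add: P_def)
  have sq: "P$i$1 * P$1$j + P$i$2 * P$2$j = P$i$j" for i j
  proof -
    have "P$i$1 * P$1$j + P$i$2 * P$2$j = cnj (v i) * v j * (v 1 * cnj (v 1) + v 2 * cnj (v 2)) / (n * n)"
      by (simp add: p add_divide_distrib algebra_simps)
    thus ?thesis using n0 by (simp add: p flip: n_def)
  qed
  have "P ** P = P" by (simp add: vec_eq_iff matrix_matrix_mult_def sum_2 sq)
  moreover have "conj_transpose P = P"
    by (simp add: vec_eq_iff conj_transpose_def p cn mult.commute)
  moreover have "rank P = 1"
  proof (rule rank_eq_1_complex)
    have "P$1$1 + P$2$2 = 1" using n0 by (simp add: p n_def add_divide_distrib[symmetric] mult.commute)
    thus "P \<noteq> 0" by auto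
    show "det P = 0" by (simp add: det_2 p)
  qed
  moreover have "(\<Sum>k\<in>UNIV. v k * (mat 1 - P) $ k $ j) = 0" for j
  proof -
    have "v 1 * P$1$j + v 2 * P$2$j = v j * (v 1 * cnj (v 1) + v 2 * cnj (v 2)) / n"
      by (simp add: p add_divide_distrib algebra_simps)
    hence "v 1 * P$1$j + v 2 * P$2$j = v j" using n0 by (simp flip: n_def)
    moreover have "v 1 * mat 1 $ 1 $ j + v 2 * mat 1 $ 2 $ j = v j"
      using exhaust_2[of j] by (auto simp: mat_def)
    ultimately show ?thesis by (simp add: sum_2 algebra_simps)
  qed
  ultimately show ?thesis unfolding orth_projection_def by blast
qed

text \<open>
  A row of analytic functions can be made divisible by \<open>q\<close> with a Blaschke--Potapov product of
  exactly the degree of \<open>q\<close>. For each new zero \<open>\<mu>\<close> the projection is chosen for the value at \<open>\<mu>\<close> of the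
  quotient \<open>h\<close> found so far: then \<open>h (I - P)\<close> vanishes at \<open>\<mu>\<close>, while \<open>h P\<close> is multiplied by the
  Blaschke factor of \<open>\<mu>\<close>.
\<close>

lemma row_divisor_blaschke_potapov:
  fixes g :: "2 \<Rightarrow> complex \<Rightarrow> complex"
  assumes "set_mset L \<subseteq> ball 0 1" "\<And>i. g i analytic_on cball 0 1"
  shows "\<exists>B h. blaschke_potapov B (size L) \<and> (\<forall>j. h j analytic_on cball 0 1) \<and>
    (\<forall>j. \<forall>z\<in>cball 0 1. (\<Sum>i\<in>UNIV. g i z * B z $ i $ j) = blaschke_prod L z * h j z)"
  using assms
proof (induction L)
  case empty
  have "unitary_matrix (mat 1 :: complex^2^2)"
    by (simp add: unitary_matrix_def conj_transpose_def vec_eq_iff forall_2 matrix_matrix_mult_def sum_2 mat_def)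
  hence "blaschke_potapov (\<lambda>z. mat 1 :: complex^2^2) 0" by (rule blaschke_potapov.unitary)
  moreover have "(\<Sum>i\<in>UNIV. g i z * mat 1 $ i $ j) = g j z" for j :: 2 and z
    using exhaust_2[of j] by (auto simp: sum_2 mat_def)
  ultimately show ?case using empty
    by (intro exI[of _ "\<lambda>z. mat 1"] exI[of _ g]) simp
next
  case (add \<mu> L)
  have "set_mset L \<subseteq> ball 0 1" using add.prems(1) by simp
  from add.IH[OF this add.prems(2)] obtain B h where Bh: "blaschke_potapov B (size L)
      \<and> (\<forall>j. h j analytic_on cball 0 1) \<and>
    (\<forall>j. \<forall>z\<in>cball 0 1. (\<Sum>i\<in>UNIV. g i z * B z $ i $ j) = blaschke_prod L z * h j z)"
    by (elim exE)
  have B: "blaschke_potapov B (size L)" and h: "\<And>j. h j analytic_on cball 0 1"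
    and eq: "\<And>j z. z \<in> cball 0 1 \<Longrightarrow> (\<Sum>i\<in>UNIV. g i z * B z $ i $ j) = blaschke_prod L z * h j z"
    using Bh by blast+
  have \<mu>: "\<mu> \<in> ball 0 1" using add.prems by auto
  obtain P :: "complex^2^2" where P: "orth_projection P" "rank P = 1"
    and P0: "\<And>j. (\<Sum>k\<in>UNIV. h k \<mu> * (mat 1 - P) $ k $ j) = 0"
    using exists_rank_one_projection[of "\<lambda>k. h k \<mu>"] by blast
  have "\<forall>j. \<exists>y. y analytic_on cball 0 1 \<and> (\<forall>z\<in>cball 0 1.
      (\<Sum>k\<in>UNIV. h k z * (mat 1 - P) $ k $ j) = blaschke_factor \<mu> z * y z)"
  proof
    fix j :: 2
    have an: "(\<lambda>z. \<Sum>k\<in>UNIV. h k z * (mat 1 - P) $ k $ j) analytic_on cball 0 1"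
      by (intro analytic_on_sum analytic_on_mult h analytic_on_const)
    show "\<exists>y. y analytic_on cball 0 1 \<and> (\<forall>z\<in>cball 0 1.
      (\<Sum>k\<in>UNIV. h k z * (mat 1 - P) $ k $ j) = blaschke_factor \<mu> z * y z)"
    proof (rule divide_by_blaschke_factor[OF an ball_subset_cball order_refl \<mu> P0])
      fix y assume "y analytic_on cball 0 1"
        "\<And>z. z \<in> cball 0 1 \<Longrightarrow> (\<Sum>k\<in>UNIV. h k z * (mat 1 - P) $ k $ j) = blaschke_factor \<mu> z * y z"
      thus ?thesis by (intro exI[of _ y]) simp
    qed
  qed
  from choice[OF this] obtain y where y': "\<forall>j. y j analytic_on cball 0 1 \<and>
    (\<forall>z\<in>cball 0 1. (\<Sum>k\<in>UNIV. h k z * (mat 1 - P) $ k $ j) = blaschke_factor \<mu> z * y j z)"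
    by (elim exE)
  have y: "\<And>j. y j analytic_on cball 0 1"
    "\<And>j z. z \<in> cball 0 1 \<Longrightarrow> (\<Sum>k\<in>UNIV. h k z * (mat 1 - P) $ k $ j) = blaschke_factor \<mu> z * y j z"
    using y' by blast+
  let ?B = "\<lambda>z. B z ** potapov_factor \<mu> P z"
  let ?h = "\<lambda>j z. (\<Sum>k\<in>UNIV. h k z * P $ k $ j) + y j z"
  have "blaschke_potapov ?B (size L + rank P)" by (rule blaschke_potapov.factor[OF B \<mu> P(1)])
  moreover have "?h j analytic_on cball 0 1" for j
    by (intro analytic_on_add analytic_on_sum analytic_on_mult h analytic_on_const y)
  moreover have "(\<Sum>i\<in>UNIV. g i z * ?B z $ i $ j) = blaschke_prod (add_mset \<mu> L) z * ?h j z"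
    if z: "z \<in> cball 0 1" for j z
  proof -
    have "(\<Sum>i\<in>UNIV. g i z * ?B z $ i $ j) = (\<Sum>k\<in>UNIV. (\<Sum>i\<in>UNIV. g i z * B z $ i $ k) * potapov_factor \<mu> P z $ k $ j)"
      by (simp add: matrix_matrix_mult_def sum_2 algebra_simps)
    also have "\<dots> = blaschke_prod L z * (\<Sum>k\<in>UNIV. h k z * potapov_factor \<mu> P z $ k $ j)"
      by (simp add: eq[OF z] sum_distrib_left mult.assoc)
    also have "(\<Sum>k\<in>UNIV. h k z * potapov_factor \<mu> P z $ k $ j) =
        blaschke_factor \<mu> z * (\<Sum>k\<in>UNIV. h k z * P $ k $ j) + (\<Sum>k\<in>UNIV. h k z * (mat 1 - P) $ k $ j)"
      by (simp add: potapov_factor_def sum_2 algebra_simps)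
    also have "\<dots> = blaschke_factor \<mu> z * ?h j z" by (simp only: y(2)[OF z] distrib_left)
    finally show ?thesis by (simp add: mult_ac)
  qed
  ultimately show ?case using P(2)
    by (intro exI[of _ ?B] exI[of _ ?h]) simp
qed

section \<open>The inner degree of a matrix with one entry of full pole order\<close>

lemma eventually_not_in_finite:
  fixes z :: complex
  assumes "finite X" "open S" "z \<in> S"
  shows "\<forall>\<^sub>F w in at z. w \<in> S - X"
proof -
  have "open (S - (X - {z}))" using assms by (intro open_Diff finite_imp_closed) auto
  hence "\<forall>\<^sub>F w in at z. w \<in> S - (X - {z}) - {z}" using assms by (intro eventually_at_in_open) auto
  thus ?thesis by eventually_elim auto
qed

lemma analytic_eq_off_finite:
  assumes "f analytic_on S" "g analytic_on S" "open S" "finite X"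
    and "\<And>z. z \<in> S - X \<Longrightarrow> f z = g z" and z: "z \<in> S"
  shows "f z = g z"
proof (rule analytic_eq_at_point[of f z g])
  show "f analytic_on {z}" "g analytic_on {z}" using assms by (auto intro: analytic_on_subset)
  show "\<forall>\<^sub>F w in at z. f w = g w"
    using eventually_not_in_finite[OF assms(4,3) z] by eventually_elim (rule assms(5))
qed

lemma remove_sings_eq_analytic:
  assumes h: "h analytic_on ball 0 1" and X: "finite X"
    and eq: "\<And>z. z \<in> ball 0 1 - X \<Longrightarrow> f z = h z" and z: "z \<in> ball 0 1"
  shows "remove_sings f z = h z"
proof (rule remove_sings_eqI)
  have "h analytic_on {z}" using h z by (auto intro: analytic_on_subset)
  hence l: "h \<midarrow>z\<rightarrow> h z" using analytic_at_imp_isCont isContD by blast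
  have "\<forall>\<^sub>F w in at z. h w = f w"
    using eventually_not_in_finite[OF X open_ball z] by eventually_elim (simp add: eq)
  with l show "f \<midarrow>z\<rightarrow> h z" by (rule Lim_transform_eventually)
qed

lemma remove_sings_bounded_analytic:
  assumes h: "h analytic_on cball 0 1" and X: "finite X"
    and eq: "\<And>z. z \<in> ball 0 1 - X \<Longrightarrow> f z = h z"
  shows "remove_sings f analytic_on ball 0 1 \<and> bounded (remove_sings f ` ball 0 1)"
proof
  have hb: "h analytic_on ball 0 1" using h ball_subset_cball analytic_on_subset by blast
  have r: "remove_sings f z = h z" if "z \<in> ball 0 1" for z
    using remove_sings_eq_analytic[OF hb X eq that] .
  have "h holomorphic_on ball 0 1" using hb analytic_imp_holomorphic by blast
  hence "remove_sings f holomorphic_on ball 0 1" by (rule holomorphic_transform) (simp add: r)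
  thus "remove_sings f analytic_on ball 0 1" by (simp add: analytic_on_open)
  have "compact (h ` cball 0 1)"
    using h by (intro compact_continuous_image analytic_imp_holomorphic holomorphic_on_imp_continuous_on) auto
  moreover have "remove_sings f ` ball 0 1 \<subseteq> h ` cball 0 1" using r by fastforce
  ultimately show "bounded (remove_sings f ` ball 0 1)" using compact_imp_bounded bounded_subset by blast
qed

text \<open>
  A two by two determinant measures the failure of the rows to be proportional. So if \<open>det A\<close> is
  divisible by \<open>q\<close> and the entry \<open>(r, c)\<close> is invertible modulo \<open>q\<close>, then row \<open>i\<close> is a multiple of row
  \<open>r\<close> modulo \<open>q\<close>. The sign \<open>\<sigma>\<close> depends on the positions only.
\<close>

lemma cofactor_identity_2:
  fixes r c i :: 2
  obtains \<sigma> :: "2 \<Rightarrow> complex" where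
    "\<And>k (A :: complex^2^2). A $ r $ c * A $ i $ k = A $ i $ c * A $ r $ k + \<sigma> k * det A"
proof
  fix k :: 2 and A :: "complex^2^2"
  show "A $ r $ c * A $ i $ k = A $ i $ c * A $ r $ k +
      (if i = r \<or> k = c then 0 else if r = c then 1 else -1) * det A"
    using exhaust_2[of r] exhaust_2[of c] exhaust_2[of i] exhaust_2[of k]
    by (elim disjE) (simp_all add: det_2 algebra_simps)
qed

definition adjugate_2 :: "complex^2^2 \<Rightarrow> complex^2^2" where
  "adjugate_2 B = (\<chi> i j. if i = 1 then if j = 1 then B$2$2 else - B$1$2
                          else if j = 1 then - B$2$1 else B$1$1)"

lemma adjugate_2_entries [simp]:
  "adjugate_2 B $ 1 $ 1 = B$2$2" "adjugate_2 B $ 1 $ 2 = - B$1$2"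
  "adjugate_2 B $ 2 $ 1 = - B$2$1" "adjugate_2 B $ 2 $ 2 = B$1$1"
  by (simp_all add: adjugate_2_def)

lemma matrix_mult_adjugate_2:
  fixes A B :: "complex^2^2"
  shows "(\<Sum>k\<in>UNIV. (A ** B) $ r $ k * adjugate_2 B $ k $ c) = det B * A $ r $ c"
proof -
  have "c = 1 \<or> c = 2" by (rule exhaust_2)
  thus ?thesis
    by (elim disjE) (simp_all add: sum_2 matrix_matrix_mult_def det_2 algebra_simps)
qed

text \<open>
  The good entry is \<open>(r, c)\<close>. Without the condition on the determinant the degree could exceed the
  number of zeros of \<open>q\<close>: at a point where all of \<open>\<Phi>\<close> has a simple pole with invertible residue, two
  rank one factors are needed.
\<close>

lemma inner_degree_eq_size:
  fixes \<Phi> M :: "complex \<Rightarrow> complex^2^2"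
  assumes L: "set_mset L \<subseteq> ball 0 1"
    and M: "\<And>i j. (\<lambda>z. M z $ i $ j) analytic_on cball 0 1"
    and E: "E analytic_on cball 0 1" "\<And>z. z \<in> cball 0 1 \<Longrightarrow> det (M z) = blaschke_prod L z * E z"
    and nz: "\<And>\<mu>. \<mu> \<in># L \<Longrightarrow> M \<mu> $ r $ c \<noteq> 0"
    and X: "finite X"
    and \<Phi>: "\<And>z i j. z \<in> ball 0 1 - X \<Longrightarrow> \<Phi> z $ i $ j = M z $ i $ j / blaschke_prod L z"
  shows "inner_degree \<Phi> = size L"
  unfolding inner_degree_def
proof (rule Least_equality)
  let ?X = "X \<union> set_mset L"
  have X': "finite ?X" using X by simp
  have qnz: "blaschke_prod L z \<noteq> 0" if "z \<in> ball 0 1 - ?X" for z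
    using blaschke_prod_zero_iff[OF L, of z] that by auto
  from row_divisor_blaschke_potapov[of L "\<lambda>i z. M z $ r $ i", OF L M]
  obtain B h where Bh': "blaschke_potapov B (size L) \<and> (\<forall>j. h j analytic_on cball 0 1) \<and>
    (\<forall>j. \<forall>z\<in>cball 0 1. (\<Sum>i\<in>UNIV. M z $ r $ i * B z $ i $ j) = blaschke_prod L z * h j z)"
    by (elim exE)
  have B: "blaschke_potapov B (size L)" and h: "\<And>j. h j analytic_on cball 0 1"
    and Bh: "\<And>j z. z \<in> cball 0 1 \<Longrightarrow> (\<Sum>i\<in>UNIV. M z $ r $ i * B z $ i $ j) = blaschke_prod L z * h j z"
    using Bh' by blast+
  have Ba: "(\<lambda>z. B z $ i $ j) analytic_on cball 0 1" for i j
    by (rule blaschke_potapov_analytic[OF B])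
  have "bounded_analytic_disk (\<lambda>z. \<Phi> z ** B z)"
    unfolding bounded_analytic_disk_def
  proof (intro allI)
    fix i j
    obtain \<sigma> where \<sigma>: "\<And>k (A :: complex^2^2). A $ r $ c * A $ i $ k = A $ i $ c * A $ r $ k + \<sigma> k * det A"
      using cofactor_identity_2[of r c i] by blast
    let ?x = "\<lambda>z. \<Sum>k\<in>UNIV. M z $ i $ k * B z $ k $ j"
    let ?g = "\<lambda>z. M z $ i $ c * h j z + E z * (\<Sum>k\<in>UNIV. \<sigma> k * B z $ k $ j)"
    have Mx: "M z $ r $ c * ?x z = blaschke_prod L z * ?g z" if z: "z \<in> cball 0 1" for z
    proof -
      have "M z $ r $ c * ?x z = (\<Sum>k\<in>UNIV. (M z $ r $ c * M z $ i $ k) * B z $ k $ j)"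
        by (simp only: sum_distrib_left mult.assoc)
      also have "\<dots> = M z $ i $ c * (\<Sum>k\<in>UNIV. M z $ r $ k * B z $ k $ j) + det (M z) * (\<Sum>k\<in>UNIV. \<sigma> k * B z $ k $ j)"
        unfolding \<sigma> by (simp add: sum_2 algebra_simps)
      also have "\<dots> = blaschke_prod L z * ?g z"
        unfolding Bh[OF z] E(2)[OF z] by (simp only: algebra_simps)
      finally show ?thesis .
    qed
    have xa: "?x analytic_on cball 0 1" by (intro analytic_on_sum analytic_on_mult M Ba)
    have ga: "?g analytic_on cball 0 1"
      by (intro analytic_on_add analytic_on_sum analytic_on_mult analytic_on_const M Ba h E(1))
    have "\<exists>x. x analytic_on cball 0 1 \<and> (\<forall>z\<in>cball 0 1. ?x z = blaschke_prod L z * x z)"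
    proof (rule blaschke_prod_dvd_cancel[OF L ball_subset_cball order_refl M xa ga nz Mx])
      fix y assume "y analytic_on cball 0 1" "\<And>z. z \<in> cball 0 1 \<Longrightarrow> ?x z = blaschke_prod L z * y z"
      thus ?thesis by (intro exI[of _ y]) simp
    qed
    then obtain x where x: "x analytic_on cball 0 1" "\<forall>z\<in>cball 0 1. ?x z = blaschke_prod L z * x z"
      by (elim exE conjE)
    show "remove_sings (\<lambda>z. (\<Phi> z ** B z) $ i $ j) analytic_on ball 0 1 \<and>
          bounded (remove_sings (\<lambda>z. (\<Phi> z ** B z) $ i $ j) ` ball 0 1)"
    proof (rule remove_sings_bounded_analytic[OF x(1) X'])
      fix z assume z: "z \<in> ball 0 1 - ?X"
      have "(\<Phi> z ** B z) $ i $ j = ?x z / blaschke_prod L z"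
        using z by (simp add: matrix_matrix_mult_def \<Phi> sum_2 add_divide_distrib)
      also have "?x z = blaschke_prod L z * x z" using x(2) z by simp
      finally show "(\<Phi> z ** B z) $ i $ j = x z" using qnz[OF z] by simp
    qed
  qed
  thus "\<exists>B. blaschke_potapov B (size L) \<and> bounded_analytic_disk (\<lambda>z. \<Phi> z ** B z)" using B by blast
next
  let ?X = "X \<union> set_mset L"
  have X': "finite ?X" using X by simp
  have qnz: "blaschke_prod L z \<noteq> 0" if "z \<in> ball 0 1 - ?X" for z
    using blaschke_prod_zero_iff[OF L, of z] that by auto
  have qa: "blaschke_prod L analytic_on ball 0 1"
    using blaschke_prod_analytic[OF L] analytic_on_subset ball_subset_cball by blast
  have Ma: "(\<lambda>z. M z $ i $ j) analytic_on ball 0 1" for i j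
    using M analytic_on_subset ball_subset_cball by blast
  fix d assume "\<exists>B :: complex \<Rightarrow> complex^2^2. blaschke_potapov B d \<and> bounded_analytic_disk (\<lambda>z. \<Phi> z ** B z)"
  then obtain B :: "complex \<Rightarrow> complex^2^2" where B: "blaschke_potapov B d" and bd:
      "bounded_analytic_disk (\<lambda>z. \<Phi> z ** B z)" by blast
  have Ba: "(\<lambda>z. B z $ i $ j) analytic_on ball 0 1" for i j
    using blaschke_potapov_analytic[OF B] analytic_on_subset ball_subset_cball by blast
  define F where "F i j = remove_sings (\<lambda>z. (\<Phi> z ** B z) $ i $ j)" for i j
  have Fa: "F i j analytic_on ball 0 1" for i j
    using bd by (simp add: F_def bounded_analytic_disk_def)
  have MB: "(M z ** B z) $ i $ j = blaschke_prod L z * F i j z" if z: "z \<in> ball 0 1" for i j z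
  proof (rule analytic_eq_off_finite[of "\<lambda>z. (M z ** B z) $ i $ j" _
      "\<lambda>z. blaschke_prod L z * F i j z", OF _ _ open_ball X' _ z])
    show MBa: "(\<lambda>z. (M z ** B z) $ i $ j) analytic_on ball 0 1"
      unfolding matrix_matrix_mult_def vec_lambda_beta
      by (intro analytic_on_sum analytic_on_mult Ma Ba)
    show "(\<lambda>z. blaschke_prod L z * F i j z) analytic_on ball 0 1"
      by (intro analytic_on_mult qa Fa)
    fix w assume w: "w \<in> ball 0 1 - ?X"
    let ?g = "\<lambda>z. (M z ** B z) $ i $ j / blaschke_prod L z"
    have g: "(\<Phi> z ** B z) $ i $ j = ?g z" if "z \<in> ball 0 1 - ?X" for z
      using that by (simp add: matrix_matrix_mult_def \<Phi> sum_2 add_divide_distrib)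
    have "?g analytic_on (ball 0 1 - ?X)"
      using qnz by (intro analytic_on_divide) (auto intro: analytic_on_subset[OF MBa] analytic_on_subset[OF qa])
    hence "?g analytic_on {w}" by (rule analytic_on_subset) (use w in simp)
    hence lim: "?g \<midarrow>w\<rightarrow> ?g w" using analytic_at_imp_isCont isContD by blast
    have "\<forall>\<^sub>F z in at w. ?g z = (\<Phi> z ** B z) $ i $ j"
    proof -
      have "\<forall>\<^sub>F z in at w. z \<in> ball 0 1 - ?X"
        by (rule eventually_not_in_finite[OF X' open_ball]) (use w in simp)
      thus ?thesis by eventually_elim (simp only: g)
    qed
    with lim have "(\<lambda>z. (\<Phi> z ** B z) $ i $ j) \<midarrow>w\<rightarrow> ?g w"
      by (rule Lim_transform_eventually)
    hence "F i j w = ?g w" unfolding F_def by (rule remove_sings_eqI)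
    thus "(M w ** B w) $ i $ j = blaschke_prod L w * F i j w" using qnz[OF w] by simp
  qed
  obtain e K where K: "e \<noteq> 0" "size K = d" "set_mset K \<subseteq> ball 0 1" "\<And>z. det (B z) = e * blaschke_prod K z"
    using det_blaschke_potapov[OF B] by blast
  define C where "C z = adjugate_2 (B z)" for z
  have Ca: "(\<lambda>z. C z $ i $ j) analytic_on ball 0 1" for i j
    using exhaust_2[of i] exhaust_2[of j]
    by (elim disjE) (simp_all add: C_def Ba analytic_on_neg)
  have "size L \<le> size K"
  proof (rule size_le_of_blaschke_dvd[OF L K(3)])
    show "(\<lambda>z. e * M z $ r $ c) analytic_on ball 0 1"
      by (intro analytic_on_mult analytic_on_const Ma)
    show "(\<lambda>z. \<Sum>k\<in>UNIV. F r k z * C z $ k $ c) analytic_on ball 0 1"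
      by (intro analytic_on_sum analytic_on_mult Fa Ca)
    show "e * M \<mu> $ r $ c \<noteq> 0" if "\<mu> \<in># L" for \<mu> using nz[OF that] K(1) by simp
    fix z :: complex assume z: "z \<in> ball 0 1"
    have "blaschke_prod K z * (e * M z $ r $ c) = det (B z) * M z $ r $ c" by (simp add: K(4))
    also have "\<dots> = (\<Sum>k\<in>UNIV. (M z ** B z) $ r $ k * C z $ k $ c)"
      unfolding C_def by (rule matrix_mult_adjugate_2[symmetric])
    also have "\<dots> = blaschke_prod L z * (\<Sum>k\<in>UNIV. F r k z * C z $ k $ c)"
      by (simp add: MB[OF z] sum_distrib_left mult.assoc)
    finally show "blaschke_prod K z * (e * M z $ r $ c) = blaschke_prod L z * (\<Sum>k\<in>UNIV. F r k z * C z $ k $ c)" .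
  qed
  thus "size L \<le> d" using K(2) by simp
qed

text \<open>
  Only the principal parts of \<open>\<Phi>\<close> in the disk matter. This is why the degree of a Riesz
  projection can be read off from the full matrix: the other projection plays the part of \<open>A\<close>.
\<close>

lemma inner_degree_eq_size_mod_analytic:
  fixes \<Phi> M A :: "complex \<Rightarrow> complex^2^2"
  assumes L: "set_mset L \<subseteq> ball 0 1"
    and M: "\<And>i j. (\<lambda>z. M z $ i $ j) analytic_on cball 0 1"
    and A: "\<And>i j. (\<lambda>z. A z $ i $ j) analytic_on cball 0 1"
    and E: "E analytic_on cball 0 1" "\<And>z. z \<in> cball 0 1 \<Longrightarrow> det (M z) = blaschke_prod L z * E z"
    and nz: "\<And>\<mu>. \<mu> \<in># L \<Longrightarrow> M \<mu> $ r $ c \<noteq> 0"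
    and X: "finite X"
    and \<Phi>: "\<And>z i j. z \<in> ball 0 1 - X \<Longrightarrow> \<Phi> z $ i $ j = M z $ i $ j / blaschke_prod L z - A z $ i $ j"
  shows "inner_degree \<Phi> = size L"
proof -
  define N where "N z = (\<chi> i j. M z $ i $ j - blaschke_prod L z * A z $ i $ j :: complex^2^2)" for z
  have N: "N z $ i $ j = M z $ i $ j - blaschke_prod L z * A z $ i $ j" for z i j by (simp add: N_def)
  note an = analytic_on_mult analytic_on_diff analytic_on_add blaschke_prod_analytic[OF L] M A E(1)
  let ?E = "\<lambda>z. E z - M z $ 1 $ 1 * A z $ 2 $ 2 - A z $ 1 $ 1 * M z $ 2 $ 2
       + M z $ 1 $ 2 * A z $ 2 $ 1 + A z $ 1 $ 2 * M z $ 2 $ 1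
       + blaschke_prod L z * (A z $ 1 $ 1 * A z $ 2 $ 2 - A z $ 1 $ 2 * A z $ 2 $ 1)"
  show ?thesis
  proof (rule inner_degree_eq_size[OF L, where M = N and X = "X \<union> set_mset L" and r = r and c = c])
    show "(\<lambda>z. N z $ i $ j) analytic_on cball 0 1" for i j unfolding N by (intro an)
    show "?E analytic_on cball 0 1"
      by (intro an)
    show "det (N z) = blaschke_prod L z * ?E z" if "z \<in> cball 0 1" for z
      using E(2)[OF that] by (simp add: det_2 N algebra_simps)
    show "N \<mu> $ r $ c \<noteq> 0" if "\<mu> \<in># L" for \<mu>
      using nz[OF that] blaschke_prod_zero_iff[OF L, of \<mu>] that L by (auto simp: N)
    show "finite (X \<union> set_mset L)" using X by simp
    fix z i j assume z: "z \<in> ball 0 1 - (X \<union> set_mset L)"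
    hence "blaschke_prod L z \<noteq> 0" using blaschke_prod_zero_iff[OF L, of z] by auto
    thus "\<Phi> z $ i $ j = N z $ i $ j / blaschke_prod L z" using \<Phi>[of z i j] z by (simp add: N field_simps)
  qed
qed

section \<open>Riesz projections of rational functions\<close>

text \<open>
  Rational functions without poles on the circle, whose Riesz projections are again rational. The
  values at the zeros of the denominator are left open, because a formula such as that for \<open>\<Psi>\<close>
  takes meaningless values there.
\<close>

definition circle_rational :: "(complex \<Rightarrow> complex) \<Rightarrow> bool" where
  "circle_rational f \<longleftrightarrow> (\<exists>P Q. (\<forall>z\<in>sphere 0 1. poly Q z \<noteq> 0) \<and> (\<forall>z. poly Q z \<noteq> 0 \<longrightarrow> f z = poly P z / poly Q z))"

lemma circle_rational_const [intro]: "circle_rational (\<lambda>_. c)"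
  unfolding circle_rational_def by (rule exI[of _ "[:c:]"], rule exI[of _ 1]) simp

lemma circle_rational_add [intro]:
  assumes "circle_rational f" "circle_rational g"
  shows "circle_rational (\<lambda>z. f z + g z)"
proof -
  obtain P Q where 1: "\<forall>z\<in>sphere 0 1. poly Q z \<noteq> 0" "\<forall>z. poly Q z \<noteq> 0 \<longrightarrow> f z = poly P z / poly Q z"
    using assms(1) circle_rational_def by auto
  obtain R S where 2: "\<forall>z\<in>sphere 0 1. poly S z \<noteq> 0" "\<forall>z. poly S z \<noteq> 0 \<longrightarrow> g z = poly R z / poly S z"
    using assms(2) circle_rational_def by auto
  show ?thesis unfolding circle_rational_def
    by (rule exI[of _ "P * S + R * Q"], rule exI[of _ "Q * S"]) (use 1 2 in \<open>auto simp: add_frac_eq\<close>)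
qed

lemma circle_rational_mult [intro]:
  assumes "circle_rational f" "circle_rational g"
  shows "circle_rational (\<lambda>z. f z * g z)"
proof -
  obtain P Q where 1: "\<forall>z\<in>sphere 0 1. poly Q z \<noteq> 0" "\<forall>z. poly Q z \<noteq> 0 \<longrightarrow> f z = poly P z / poly Q z"
    using assms(1) circle_rational_def by auto
  obtain R S where 2: "\<forall>z\<in>sphere 0 1. poly S z \<noteq> 0" "\<forall>z. poly S z \<noteq> 0 \<longrightarrow> g z = poly R z / poly S z"
    using assms(2) circle_rational_def by auto
  show ?thesis unfolding circle_rational_def
    by (rule exI[of _ "P * R"], rule exI[of _ "Q * S"]) (use 1 2 in auto)
qed

lemma circle_rational_blaschke_factor:
  assumes "\<mu> \<in> ball 0 1"
  shows "circle_rational (blaschke_factor \<mu>)" "circle_rational (\<lambda>z. 1 / blaschke_factor \<mu> z)"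
proof -
  show "circle_rational (blaschke_factor \<mu>)" unfolding circle_rational_def
    by (rule exI[of _ "[:\<mu>, -1:]"], rule exI[of _ "[:1, - cnj \<mu>:]"])
       (use blaschke_factor_denom_nonzero[OF assms] in \<open>auto simp: blaschke_factor_def mult.commute\<close>)
  show "circle_rational (\<lambda>z. 1 / blaschke_factor \<mu> z)" unfolding circle_rational_def
    by (rule exI[of _ "[:1, - cnj \<mu>:]"], rule exI[of _ "[:\<mu>, -1:]"])
       (use assms in \<open>auto simp: blaschke_factor_def mult.commute\<close>)
qed

lemma circle_rational_blaschke_prod:
  assumes "set_mset L \<subseteq> ball 0 1"
  shows "circle_rational (blaschke_prod L)" "circle_rational (\<lambda>z. 1 / blaschke_prod L z)"
proof -
  have "circle_rational (\<lambda>z. blaschke_prod L z) \<and> circle_rational (\<lambda>z. 1 / blaschke_prod L z)"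
    using assms
  proof (induction L)
    case (add \<mu> L)
    have "circle_rational (\<lambda>z. blaschke_factor \<mu> z * blaschke_prod L z)"
      "circle_rational (\<lambda>z. (1 / blaschke_factor \<mu> z) * (1 / blaschke_prod L z))"
      using add circle_rational_blaschke_factor[of \<mu>] by (intro circle_rational_mult; auto)+
    thus ?case by simp
  qed (auto simp: blaschke_prod_def[abs_def])
  thus "circle_rational (blaschke_prod L)" "circle_rational (\<lambda>z. 1 / blaschke_prod L z)" by auto
qed

text \<open>
  Reducing the fraction changes values only at zeros of the old denominator, none of which lies on
  the circle in the application.
\<close>

lemma rational_function_normal_form:
  fixes P Q :: "complex poly"
  assumes "Q \<noteq> 0"
  shows "\<exists>f. rational_function f \<and> (\<forall>z. poly Q z \<noteq> 0 \<longrightarrow> f z = poly P z / poly Q z)"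
proof -
  let ?g = "gcd P Q"
  have g: "P = ?g * (P div ?g)" "Q = ?g * (Q div ?g)" by simp_all
  have "coprime (P div ?g) (Q div ?g)" by (rule div_gcd_coprime) (use assms in simp)
  moreover have "Q div ?g \<noteq> 0" using assms g(2) by (metis mult_zero_right)
  ultimately have "rational_function (\<lambda>z. poly (P div ?g) z / poly (Q div ?g) z)"
    unfolding rational_function_def by blast
  moreover have "poly (P div ?g) z / poly (Q div ?g) z = poly P z / poly Q z" if "poly Q z \<noteq> 0" for z
  proof -
    have "poly P z = poly ?g z * poly (P div ?g) z" "poly Q z = poly ?g z * poly (Q div ?g) z"
      using g by (metis poly_mult)+
    thus ?thesis using that by simp
  qed
  ultimately show ?thesis by blast
qed

lemma analytic_on_poly_quotient:
  fixes P Q :: "complex poly"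
  assumes "\<And>z. z \<in> S \<Longrightarrow> poly Q z \<noteq> 0" and f: "\<And>z. poly Q z \<noteq> 0 \<Longrightarrow> f z = poly P z / poly Q z"
  shows "f analytic_on S"
proof -
  let ?T = "- {z. poly Q z = 0}"
  have o: "open ?T"
  proof -
    have "closed {z. poly Q z = 0}" by (intro closed_Collect_eq continuous_intros)
    thus ?thesis by (simp add: open_closed)
  qed
  have "(\<lambda>z. poly P z / poly Q z) holomorphic_on ?T"
    by (intro holomorphic_intros) auto
  moreover have "(\<lambda>z. poly P z / poly Q z) holomorphic_on ?T \<longleftrightarrow> f holomorphic_on ?T"
    by (rule holomorphic_cong) (auto simp: f)
  ultimately have "f holomorphic_on ?T" by simp
  thus ?thesis using o assms(1) unfolding analytic_on_holomorphic by (intro exI[of _ ?T]) auto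
qed

lemma poly_split_at_circle:
  fixes Q :: "complex poly"
  assumes "\<And>z. z \<in> sphere 0 1 \<Longrightarrow> poly Q z \<noteq> 0"
  obtains Q1 Q2 where "Q = Q1 * Q2" "\<And>z. poly Q1 z = 0 \<Longrightarrow> z \<in> ball 0 1" "\<And>z. poly Q2 z = 0 \<Longrightarrow> z \<notin> cball 0 1"
  using assms
proof (induction "degree Q" arbitrary: Q thesis)
  case 0
  then obtain c where c: "Q = [:c:]" by (metis degree_eq_zeroE)
  have "c \<noteq> 0" using 0(3)[of 1] c by auto
  thus ?case using 0(2)[of Q 1] c by auto
next
  case (Suc n)
  have "\<not> constant (poly Q)" using Suc(2) by (simp add: constant_degree)
  then obtain r where r: "poly Q r = 0" using fundamental_theorem_of_algebra by blast
  then obtain R where R: "Q = [:-r, 1:] * R" by (metis poly_eq_0_iff_dvd dvdE)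
  have "R \<noteq> 0" using R Suc(2) by auto
  hence "degree Q = Suc (degree R)" unfolding R by (subst degree_mult_eq) auto
  hence d: "n = degree R" using Suc(2) by simp
  have Rn: "poly R z \<noteq> 0" if "z \<in> sphere 0 1" for z using Suc(4)[OF that] R by auto
  obtain Q1 Q2 where Q: "R = Q1 * Q2" "\<And>z. poly Q1 z = 0 \<Longrightarrow> z \<in> ball 0 1" "\<And>z. poly Q2 z = 0 \<Longrightarrow> z \<notin> cball 0 1"
    using Suc(1)[OF d _ Rn] by metis
  show ?case
  proof (cases "r \<in> ball 0 1")
    case True
    show ?thesis
    proof (rule Suc(3))
      show "Q = ([:-r, 1:] * Q1) * Q2" by (simp only: R Q(1) mult.assoc)
      show "z \<in> ball 0 1" if "poly ([:-r, 1:] * Q1) z = 0" for z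
        using that Q(2) True by auto
    qed (rule Q(3))
  next
    case False
    have "r \<notin> sphere 0 1" using r Suc(4) by blast
    hence r': "r \<notin> cball 0 1" using False by auto
    show ?thesis
    proof (rule Suc(3))
      show "Q = Q1 * ([:-r, 1:] * Q2)" by (simp only: R Q(1) mult_ac)
      show "z \<notin> cball 0 1" if "poly ([:-r, 1:] * Q2) z = 0" for z
        using that Q(3) r' by auto
    qed (rule Q(2))
  qed
qed

lemma coprime_poly_no_common_root:
  fixes p q :: "complex poly"
  assumes "\<And>z. poly p z = 0 \<Longrightarrow> poly q z \<noteq> 0"
  shows "coprime p q"
proof (rule coprimeI)
  fix c assume c: "c dvd p" "c dvd q"
  have "constant (poly c)"
  proof (rule ccontr)
    assume "\<not> constant (poly c)"
    then obtain z where z: "poly c z = 0" using fundamental_theorem_of_algebra by blast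
    obtain k l where "p = c * k" "q = c * l" using c by (elim dvdE)
    thus False using assms[of z] z by simp
  qed
  moreover have "c \<noteq> 0" using c assms[of 0] by auto
  ultimately show "is_unit c" by (simp add: constant_degree is_unit_iff_degree)
qed

text \<open>
  The numerator over the poles in the disk has smaller degree than its denominator: this part
  vanishes at infinity, as the antianalytic projection must. The polynomial part goes with the
  poles outside.
\<close>

lemma partial_fractions_at_circle:
  fixes P Q :: "complex poly"
  assumes "\<And>z. z \<in> sphere 0 1 \<Longrightarrow> poly Q z \<noteq> 0"
  obtains C Q2 A Q1 where "\<And>z. poly Q1 z = 0 \<Longrightarrow> z \<in> ball 0 1" "\<And>z. poly Q2 z = 0 \<Longrightarrow> z \<notin> cball 0 1"
    "A = 0 \<or> degree A < degree Q1"
    "\<And>z. poly Q z \<noteq> 0 \<Longrightarrow> poly Q1 z \<noteq> 0 \<and> poly Q2 z \<noteq> 0 \<and>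
        poly P z / poly Q z = poly C z / poly Q2 z + poly A z / poly Q1 z"
proof -
  obtain Q1 Q2 where Q: "Q = Q1 * Q2" "\<And>z. poly Q1 z = 0 \<Longrightarrow> z \<in> ball 0 1" "\<And>z. poly Q2 z = 0 \<Longrightarrow> z \<notin> cball 0 1"
    using poly_split_at_circle[OF assms] by blast
  have "coprime Q1 Q2" using Q ball_subset_cball by (intro coprime_poly_no_common_root) blast
  then obtain u v where uv: "u * Q1 + v * Q2 = 1"
    using bezout_coefficients_fst_snd[of Q1 Q2] by (metis coprime_iff_gcd_eq_1)
  have Q1: "Q1 \<noteq> 0" using Q(2)[of 2] by auto
  define D A where "D = (P * v) div Q1" and "A = (P * v) mod Q1"
  have DA: "P * v = D * Q1 + A" by (simp add: D_def A_def)
  have "P = P * (u * Q1 + v * Q2)" by (simp add: uv)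
  also have "\<dots> = (P * u + D * Q2) * Q1 + A * Q2"
    using arg_cong[OF DA, of "\<lambda>p. p * Q2"] by (simp add: algebra_simps)
  finally have "P = (P * u + D * Q2) * Q1 + A * Q2" .
  define C where "C = P * u + D * Q2"
  have P: "poly P z = poly C z * poly Q1 z + poly A z * poly Q2 z" for z
    using \<open>P = (P * u + D * Q2) * Q1 + A * Q2\<close> unfolding C_def[symmetric] by (metis poly_add poly_mult)
  show thesis
  proof (rule that[OF Q(2,3)])
    show "A = 0 \<or> degree A < degree Q1" unfolding A_def using Q1 by (rule degree_mod_less)
    fix z assume z: "poly Q z \<noteq> 0"
    have n: "poly Q1 z \<noteq> 0" "poly Q2 z \<noteq> 0" using z Q(1) by auto
    have "poly P z / poly Q z = (poly C z * poly Q1 z + poly A z * poly Q2 z) / (poly Q1 z * poly Q2 z)"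
      unfolding P[of z] by (simp only: Q(1) poly_mult)
    also have "\<dots> = poly C z / poly Q2 z + poly A z / poly Q1 z"
      using n by (simp add: add_divide_distrib)
    finally show "poly Q1 z \<noteq> 0 \<and> poly Q2 z \<noteq> 0 \<and>
        poly P z / poly Q z = poly C z / poly Q2 z + poly A z / poly Q1 z" using n by blast
  qed
qed

lemma fourier_coeff_analytic:
  assumes "g analytic_on cball 0 1"
  shows "fourier_coeff g (int n) = (deriv ^^ n) g 0 / fact n"
proof -
  have h: "g holomorphic_on cball 0 1" using assms analytic_imp_holomorphic by blast
  have "2 * pi * \<i> / fact n * (deriv ^^ n) g 0 = contour_integral (circlepath 0 1) (\<lambda>u. g u / (u - 0) ^ Suc n)"
  proof (rule sym, rule contour_integral_unique, rule Cauchy_has_contour_integral_higher_derivative_circlepath)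
    show "continuous_on (cball 0 1) g" using h holomorphic_on_imp_continuous_on by blast
    show "g holomorphic_on ball 0 1" using h holomorphic_on_subset ball_subset_cball by blast
  qed simp
  also have "\<dots> = integral {0..2*pi} (\<lambda>t. g (0 + of_real 1 * cis t) / (0
      + of_real 1 * cis t - 0) ^ Suc n * of_real 1 * \<i> * cis t)"
    unfolding circlepath_def by (rule contour_integral_part_circlepath_eq) simp
  also have "\<dots> = integral {0..2*pi} (\<lambda>t. \<i> * (g (cis t) * cis (- of_int (int n) * t)))"
  proof (rule integral_cong)
    fix t :: real
    have "cis (- of_int (int n) * t) = cis (real n * - t)" by simp
    also have "\<dots> = cis (- t) ^ n" by (rule Complex.DeMoivre[symmetric])
    also have "\<dots> = inverse (cis t ^ n)" by (simp add: power_inverse flip: cis_inverse)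
    finally have "cis (- of_int (int n) * t) = inverse (cis t ^ n)" .
    thus "g (0 + of_real 1 * cis t) / (0 + of_real 1 * cis t - 0) ^ Suc n * of_real 1 * \<i> * cis t =
        \<i> * (g (cis t) * cis (- of_int (int n) * t))" by (simp add: field_simps)
  qed
  also have "\<dots> = \<i> * integral {0..2*pi} (\<lambda>t. g (cis t) * cis (- of_int (int n) * t))"
    by (rule integral_mult_right)
  finally have "\<i> * (2 * pi * ((deriv ^^ n) g 0 / fact n))
      = \<i> * integral {0..2*pi} (\<lambda>t. g (cis t) * cis (- of_int (int n) * t))"
    by (simp add: field_simps)
  hence e: "2 * pi * ((deriv ^^ n) g 0 / fact n) = integral {0..2*pi} (\<lambda>t. g (cis t) * cis (- of_int (int n) * t))"
    by (metis mult_left_cancel complex_i_not_zero)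
  have "fourier_coeff g (int n) = 2 * pi * ((deriv ^^ n) g 0 / fact n) / (2 * pi)"
    unfolding fourier_coeff_def e ..
  thus ?thesis by simp
qed

text \<open>
  After the substitution \<open>\<theta> \<mapsto> - \<theta>\<close> the integral becomes that of the analytic function \<open>h(z) z\<^sup>n\<close>
  around the circle.
\<close>

lemma fourier_coeff_antianalytic:
  assumes h: "h analytic_on cball 0 1" and g: "\<And>z. z \<in> sphere 0 1 \<Longrightarrow> g z = h (1 / z) / z"
  shows "fourier_coeff g (int n) = 0"
proof -
  define \<phi> where "\<phi> t = h (cis t) * cis t ^ n * cis t" for t
  have "integral {0..2*pi} (\<lambda>t. g (cis t) * cis (- of_int (int n) * t)) = integral {0..2*pi} (\<lambda>t. \<phi> (- t))"
  proof (rule integral_cong)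
    fix t :: real
    have "1 / cis t = cis (- t)" by (simp add: cis_inverse[symmetric] field_simps)
    moreover have "cis (- of_int (int n) * t) = cis (- t) ^ n"
      using Complex.DeMoivre[of "- t" n] by simp
    ultimately show "g (cis t) * cis (- of_int (int n) * t) = \<phi> (- t)"
      by (simp add: g \<phi>_def divide_inverse cis_inverse mult_ac)
  qed
  also have "\<dots> = integral {-(2*pi)..-0} \<phi>" 
    using Henstock_Kurzweil_Integration.integral_reflect_real[of "2*pi" 0 "\<lambda>t. \<phi> (- t)"] by simp
  finally have 1: "integral {0..2*pi} (\<lambda>t. g (cis t) * cis (- of_int (int n) * t)) = integral {-(2*pi)..0} \<phi>" by simp
  have "0 = contour_integral (part_circlepath 0 1 (-(2*pi)) 0) (\<lambda>z. h z * z ^ n)"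
  proof (rule sym, rule contour_integral_unique, rule Cauchy_theorem_convex_simple)
    show "(\<lambda>z. h z * z ^ n) holomorphic_on cball 0 1"
      using h by (intro holomorphic_intros analytic_imp_holomorphic)
    show "path_image (part_circlepath 0 1 (-(2*pi)) 0) \<subseteq> cball (0::complex) 1"
      using path_image_part_circlepath_subset'[of 1 0 "-(2*pi)" 0] sphere_cball by fastforce
    show "pathfinish (part_circlepath 0 1 (-(2*pi)) 0) = pathstart (part_circlepath 0 1 (-(2*pi)) 0)"
      using exp_two_pi_i by (simp add: exp_minus mult_ac)
  qed auto
  also have "\<dots> = integral {-(2*pi)..0} (\<lambda>t. h (0 + of_real 1 * cis t) * (0
      + of_real 1 * cis t) ^ n * of_real 1 * \<i> * cis t)"
    by (rule contour_integral_part_circlepath_eq) simp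
  also have "\<dots> = integral {-(2*pi)..0} (\<lambda>t. \<i> * \<phi> t)"
    by (rule integral_cong) (simp add: \<phi>_def mult_ac)
  also have "\<dots> = \<i> * integral {-(2*pi)..0} \<phi>" by (rule integral_mult_right)
  finally show ?thesis using 1 by (simp add: fourier_coeff_def)
qed

text \<open>
  Analyticity on the closed disk means analyticity on a slightly larger disk, so the Taylor series
  still converges on the circle.
\<close>

lemma taylor_sums_on_cball:
  assumes "g analytic_on cball 0 1" "z \<in> cball 0 1"
  shows "(\<lambda>n. (deriv ^^ n) g 0 / fact n * z ^ n) sums g z"
proof -
  obtain T where T: "open T" "cball 0 1 \<subseteq> T" "g holomorphic_on T"
    using assms(1) analytic_on_holomorphic by auto
  obtain e where e: "e > 0" "(\<Union>x\<in>cball 0 1. ball x e) \<subseteq> T"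
    using compact_subset_open_imp_ball_epsilon_subset[OF compact_cball T(1,2)] by blast
  have "ball 0 (1 + e) \<subseteq> T"
  proof
    fix w :: complex assume w: "w \<in> ball 0 (1 + e)"
    show "w \<in> T"
    proof (cases "w \<in> cball 0 1")
      case False
      hence "cmod w > 1" by simp
      hence "w \<in> ball (w / cmod w) e"
      proof -
        have "w / cmod w - w = of_real (1 / cmod w - 1) * w" by (simp add: algebra_simps)
        hence "dist (w / cmod w) w = \<bar>1 / cmod w - 1\<bar> * cmod w"
            by (simp add: dist_norm norm_mult del: of_real_diff of_real_divide)
        also have "\<dots> = cmod w - 1" using \<open>cmod w > 1\<close> by (auto simp: abs_if field_simps)
        finally show ?thesis using w by simp
      qed
      moreover have "w / cmod w \<in> cball 0 1" by (simp add: norm_divide)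
      ultimately show ?thesis using e(2) by blast
    qed (use T in blast)
  qed
  hence "g holomorphic_on ball 0 (1 + e)" using T(3) holomorphic_on_subset by blast
  moreover have "z \<in> ball 0 (1 + e)" using assms(2) e(1) by auto
  ultimately have "(\<lambda>n. (deriv ^^ n) g 0 / fact n * (z - 0) ^ n) sums g z" by (rule holomorphic_power_series)
  thus ?thesis by simp
qed

lemma fourier_coeff_add:
  assumes "continuous_on (sphere 0 1) p" "continuous_on (sphere 0 1) m"
    and "\<And>z. z \<in> sphere 0 1 \<Longrightarrow> f z = p z + m z"
  shows "fourier_coeff f k = fourier_coeff p k + fourier_coeff m k"
proof -
  have int: "(\<lambda>t. g (cis t) * cis (- of_int k * t)) integrable_on {0..2*pi}"
    if "continuous_on (sphere 0 1) g" for g :: "complex \<Rightarrow> complex"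
    by (intro integrable_continuous_interval continuous_intros continuous_on_compose2[OF that]) auto
  have "integral {0..2*pi} (\<lambda>t. f (cis t) * cis (- of_int k * t)) =
    integral {0..2*pi} (\<lambda>t. p (cis t) * cis (- of_int k * t) + m (cis t) * cis (- of_int k * t))"
    by (rule integral_cong) (simp add: assms(3) algebra_simps)
  also have "\<dots> = integral {0..2*pi} (\<lambda>t. p (cis t) * cis (- of_int k * t))
      + integral {0..2*pi} (\<lambda>t. m (cis t) * cis (- of_int k * t))"
    by (intro Henstock_Kurzweil_Integration.integral_add int assms)
  finally show ?thesis by (simp add: fourier_coeff_def add_divide_distrib)
qed

text \<open>
  Here \<open>p\<close> and \<open>m\<close> are the analytic and the antianalytic projection of \<open>f\<close>, and \<open>h\<close> certifies that
  \<open>m\<close> is analytic outside the disk and vanishes at infinity. The set \<open>X\<close> collects the points where the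
  formula for \<open>f\<close> may take a meaningless value.
\<close>

definition riesz_split ::
    "(complex \<Rightarrow> complex) \<Rightarrow> (complex \<Rightarrow> complex) \<Rightarrow> (complex \<Rightarrow> complex) \<Rightarrow> (complex \<Rightarrow> complex) \<Rightarrow> complex set \<Rightarrow> bool" where
  "riesz_split f p m h X \<longleftrightarrow> rational_function p \<and> rational_function m \<and>
    p analytic_on cball 0 1 \<and> m analytic_on - ball 0 1 \<and> h analytic_on cball 0 1 \<and>
    (\<forall>z\<in>cball 0 1 - {0}. m (1 / z) = z * h z) \<and>
    finite X \<and> (\<forall>z. z \<notin> X \<longrightarrow> f z = p z + m z) \<and> (\<forall>z\<in>sphere 0 1. f z = p z + m z) \<and>
    (\<forall>z\<in>sphere 0 1. (\<Sum>n. fourier_coeff f (int n) * z ^ n) = p z)"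

lemma riesz_split_exists:
  assumes "circle_rational f"
  shows "\<exists>p m h X. riesz_split f p m h X"
proof -
  from assms obtain P Q where "(\<forall>z\<in>sphere 0 1. poly Q z \<noteq> 0) \<and> (\<forall>z. poly Q z \<noteq> 0 \<longrightarrow> f z = poly P z / poly Q z)"
    unfolding circle_rational_def by (elim exE)
  hence PQ: "\<And>z. z \<in> sphere 0 1 \<Longrightarrow> poly Q z \<noteq> 0" "\<And>z. poly Q z \<noteq> 0 \<Longrightarrow> f z = poly P z / poly Q z"
    by blast+
  obtain C Q2 A Q1 where Q1: "\<And>z. poly Q1 z = 0 \<Longrightarrow> z \<in> ball 0 1" and Q2: "\<And>z. poly Q2 z = 0 \<Longrightarrow> z \<notin> cball 0 1"
    and A: "A = 0 \<or> degree A < degree Q1"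
    and pf: "\<And>z. poly Q z \<noteq> 0 \<Longrightarrow> poly Q1 z \<noteq> 0 \<and> poly Q2 z \<noteq> 0 \<and>
        poly P z / poly Q z = poly C z / poly Q2 z + poly A z / poly Q1 z"
    using partial_fractions_at_circle[OF PQ(1)] by metis
  have nz: "Q1 \<noteq> 0" "Q2 \<noteq> 0" "Q \<noteq> 0" using Q1[of 2] Q2[of 0] PQ(1)[of 1] by auto
  obtain p where p: "rational_function p" "\<And>z. poly Q2 z \<noteq> 0 \<Longrightarrow> p z = poly C z / poly Q2 z"
    using rational_function_normal_form[OF nz(2)] by blast
  obtain m where m: "rational_function m" "\<And>z. poly Q1 z \<noteq> 0 \<Longrightarrow> m z = poly A z / poly Q1 z"
    using rational_function_normal_form[OF nz(1)] by blast
  have pa: "p analytic_on cball 0 1" using Q2 p(2) by (intro analytic_on_poly_quotient) auto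
  have ma: "m analytic_on - ball 0 1" using Q1 m(2) by (intro analytic_on_poly_quotient) auto
  have "\<exists>h. h analytic_on cball 0 1 \<and> (\<forall>z\<in>cball 0 1 - {0}. m (1 / z) = z * h z)"
  proof (cases "A = 0")
    case True
    have "m (1 / z) = z * 0" if z: "z \<in> cball 0 1 - {0}" for z
    proof -
      have "poly Q1 (1 / z) \<noteq> 0" using Q1[of "1/z"] z by (auto simp: norm_divide divide_simps)
      thus ?thesis using m(2) True by simp
    qed
    thus ?thesis by (intro exI[of _ "\<lambda>_. 0"]) (auto simp: analytic_on_const)
  next
    case False
    hence d: "degree A < degree Q1" using A by simp
    let ?A = "monom 1 (degree Q1 - degree A - 1) * reflect_poly A" and ?Q = "reflect_poly Q1"
    have inv: "poly Q1 (1 / z) \<noteq> 0" if z: "z \<in> cball 0 1 - {0}" for z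
      using Q1[of "1/z"] z by (auto simp: norm_divide divide_simps)
    have Qn: "poly ?Q z \<noteq> 0" if "z \<in> cball 0 1" for z
      using inv[of z] that nz(1) by (cases "z = 0") (auto simp: poly_reflect_poly_nz inverse_eq_divide)
    have "(\<lambda>z. poly ?A z / poly ?Q z) analytic_on cball 0 1"
      by (rule analytic_on_poly_quotient[where P = ?A and Q = ?Q]) (use Qn in auto)
    moreover have "m (1 / z) = z * (poly ?A z / poly ?Q z)" if z: "z \<in> cball 0 1 - {0}" for z
    proof -
      have z0: "z \<noteq> 0" using z by auto
      have "z ^ degree Q1 = z ^ (1 + (degree Q1 - degree A - 1) + degree A)" using d by simp
      also have "\<dots> = z * z ^ (degree Q1 - degree A - 1) * z ^ degree A" by (simp only: power_add power_one_right)
      finally have e: "z ^ degree Q1 = z * z ^ (degree Q1 - degree A - 1) * z ^ degree A" .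
      have "z * (poly ?A z / poly ?Q z) =
        (z * z ^ (degree Q1 - degree A - 1) * z ^ degree A) * poly A (1 / z) / (z ^ degree Q1 * poly Q1 (1 / z))"
        using z0 by (simp add: poly_reflect_poly_nz poly_monom inverse_eq_divide mult_ac)
      also have "\<dots> = poly A (1 / z) / poly Q1 (1 / z)" unfolding e[symmetric] using z0 by simp
      finally show ?thesis using m(2)[OF inv[OF z]] by simp
    qed
    ultimately show ?thesis by blast
  qed
  then obtain h where h: "h analytic_on cball 0 1" "\<And>z. z \<in> cball 0 1 - {0} \<Longrightarrow> m (1 / z) = z * h z" by blast
  have eq: "f z = p z + m z" if "poly Q z \<noteq> 0" for z
    using pf[OF that] PQ(2)[OF that] p(2) m(2) by simp
  have eqs: "f z = p z + m z" if "z \<in> sphere 0 1" for z using eq PQ(1) that by blast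
  have ms: "m z = h (1 / z) / z" if "z \<in> sphere 0 1" for z
  proof -
    have "z \<noteq> 0" using that by auto
    thus ?thesis using h(2)[of "1 / z"] that by (auto simp: norm_divide)
  qed
  have cp: "continuous_on (sphere 0 1) p"
    using pa analytic_on_subset[of p "cball 0 1" "sphere 0 1"]
        by (auto intro!: holomorphic_on_imp_continuous_on analytic_imp_holomorphic)
  have sub: "sphere 0 1 \<subseteq> - ball (0::complex) 1" by auto
  have cm: "continuous_on (sphere 0 1) m"
    using ma analytic_on_subset[of m "- ball 0 1" "sphere 0 1", OF _ sub]
        by (auto intro!: holomorphic_on_imp_continuous_on analytic_imp_holomorphic)
  have fc: "fourier_coeff f (int n) = (deriv ^^ n) p 0 / fact n" for n
    using fourier_coeff_add[OF cp cm eqs] fourier_coeff_antianalytic[OF h(1) ms] fourier_coeff_analytic[OF pa] by simp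
  have "(\<Sum>n. fourier_coeff f (int n) * z ^ n) = p z" if "z \<in> sphere 0 1" for z
    unfolding fc using taylor_sums_on_cball[OF pa, of z] that sphere_cball by (intro sums_unique[symmetric]) auto
  moreover have "finite {z. poly Q z = 0}" using nz(3) by (rule poly_roots_finite)
  ultimately have "riesz_split f p m h {z. poly Q z = 0}"
    unfolding riesz_split_def using p(1) m(1) pa ma h eq eqs by blast
  thus ?thesis by blast
qed

text \<open>
  The matrices \<open>R\<close> and \<open>S\<close> are the rational functions whose McMillan degrees are compared in the
  theorem.
\<close>

lemma riesz_matrix_decomposition:
  fixes \<Phi> :: "complex \<Rightarrow> complex^'n^'m"
  assumes "\<And>i j. circle_rational (\<lambda>z. \<Phi> z $ i $ j)"
  obtains R S :: "complex \<Rightarrow> complex^'n^'m" and H X where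
    "rational_extension (riesz_plus \<Phi>) = R" "rational_extension (riesz_minus \<Phi>) = S"
    "\<And>i j. (\<lambda>z. R z $ i $ j) analytic_on cball 0 1" "\<And>i j. (\<lambda>z. S z $ i $ j) analytic_on - ball 0 1"
    "\<And>i j. (\<lambda>z. H z $ i $ j) analytic_on cball 0 1"
    "\<And>z i j. z \<in> cball 0 1 - {0} \<Longrightarrow> S (1 / z) $ i $ j = z * H z $ i $ j"
    "finite X" "\<And>z i j. z \<notin> X \<Longrightarrow> \<Phi> z $ i $ j = R z $ i $ j + S z $ i $ j"
proof -
  have "\<forall>i j. \<exists>p m h X. riesz_split (\<lambda>z. \<Phi> z $ i $ j) p m h X"
    using riesz_split_exists[OF assms] by blast
  then obtain p m h X where "\<And>i j. riesz_split (\<lambda>z. \<Phi> z $ i $ j) (p i j) (m i j) (h i j) (X i j)"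
    by metis
  note D = this[unfolded riesz_split_def]
  define R S H where "R z = (\<chi> i j. p i j z :: complex^'n^'m)" and "S z = (\<chi> i j. m i j z :: complex^'n^'m)"
    and "H z = (\<chi> i j. h i j z :: complex^'n^'m)" for z
  have entries: "R z $ i $ j = p i j z" "S z $ i $ j = m i j z" "H z $ i $ j = h i j z" for z i j
    by (simp_all add: R_def S_def H_def)
  have plus: "riesz_plus \<Phi> z $ i $ j = p i j z" if "z \<in> sphere 0 1" for z i j
    using D[of i j] that by (simp add: riesz_plus_def)
  show thesis
  proof (rule that[of R S H "\<Union>i j. X i j"])
    show "rational_extension (riesz_plus \<Phi>) = R"
      by (rule rational_extension_eqI) (use D plus in \<open>auto simp: rational_matrix_def entries vec_eq_iff\<close>)
    show "rational_extension (riesz_minus \<Phi>) = S"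
      by (rule rational_extension_eqI)
         (use D plus in \<open>auto simp: rational_matrix_def entries vec_eq_iff riesz_minus_def\<close>)
    show "(\<lambda>z. R z $ i $ j) analytic_on cball 0 1" "(\<lambda>z. S z $ i $ j) analytic_on - ball 0 1"
      "(\<lambda>z. H z $ i $ j) analytic_on cball 0 1" for i j
      unfolding entries using D[of i j] by blast+
    show "S (1 / z) $ i $ j = z * H z $ i $ j" if "z \<in> cball 0 1 - {0}" for z i j
      unfolding entries using D[of i j] that by blast
    show "finite (\<Union>i j. X i j)" using D by (intro finite_UN_I finite) blast
    show "\<Phi> z $ i $ j = R z $ i $ j + S z $ i $ j" if "z \<notin> (\<Union>i j. X i j)" for z i j
      unfolding entries using D[of i j] that by blast
  qed
qed

section \<open>McMillan degrees of the two projections\<close>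

text \<open>
  The hypothesis on \<open>H\<close> excludes a pole at infinity.
\<close>

lemma mcmillan_degree_poles_in_disk:
  fixes S :: "complex \<Rightarrow> complex^'n^'m"
  assumes S: "\<And>i j. (\<lambda>z. S z $ i $ j) analytic_on - ball 0 1"
    and H: "\<And>i j. (\<lambda>z. H z $ i $ j) analytic_on cball 0 1"
    and SH: "\<And>z i j. z \<in> cball 0 1 - {0} \<Longrightarrow> S (1 / z) $ i $ j = z * H z $ i $ j"
  shows "mcmillan_degree S = inner_degree S"
proof -
  have "z \<in> ball 0 1" if p: "has_pole S z" for z
  proof (rule ccontr)
    assume z: "z \<notin> ball 0 1"
    from p obtain i j where "is_pole (\<lambda>w. S w $ i $ j) z" unfolding has_pole_def by blast
    moreover have "(\<lambda>w. S w $ i $ j) analytic_on {z}"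
      by (rule analytic_on_subset[OF S]) (use z in auto)
    ultimately show False using analytic_at_imp_no_pole by blast
  qed
  moreover have "\<not> has_pole_at_infinity S"
  proof
    assume "has_pole_at_infinity S"
    then obtain i j where p: "is_pole (\<lambda>w. S (1 / w) $ i $ j) 0"
      by (auto simp: has_pole_at_infinity_def has_pole_def flat_def)
    have "\<forall>\<^sub>F z in at 0. z \<in> ball (0::complex) 1 - {0}"
      by (rule eventually_at_in_open) auto
    hence "\<forall>\<^sub>F z in at 0. S (1 / z) $ i $ j = z * H z $ i $ j"
      by eventually_elim (rule SH, auto)
    hence "is_pole (\<lambda>z. z * H z $ i $ j) 0" by (rule is_pole_transform[OF p _ refl])
    moreover have "(\<lambda>z. z * H z $ i $ j) analytic_on {0}"
      by (intro analytic_on_mult analytic_on_ident analytic_on_subset[OF H]) auto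
    ultimately show False using analytic_at_imp_no_pole by blast
  qed
  ultimately show ?thesis by (simp add: mcmillan_degree_def)
qed

text \<open>
  The pole of \<open>flat R\<close> is needed to know that the first case of the definition of the degree does
  not apply: it is a pole of \<open>R\<close> outside the disk, or at infinity if \<open>\<mu> = 0\<close>.
\<close>

lemma mcmillan_degree_poles_outside:
  fixes R :: "complex \<Rightarrow> complex^'n^'m"
  assumes R: "\<And>i j. (\<lambda>z. R z $ i $ j) analytic_on cball 0 1"
    and \<mu>: "\<mu> \<in> ball 0 1" and pole: "is_pole (\<lambda>z. flat R z $ i $ j) \<mu>"
  shows "mcmillan_degree R = inner_degree (flat R)"
proof -
  have 1: "\<not> ((\<forall>z. has_pole R z \<longrightarrow> z \<in> ball 0 1) \<and> \<not> has_pole_at_infinity R)"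
  proof (cases "\<mu> = 0")
    case True
    thus ?thesis using pole by (auto simp: has_pole_at_infinity_def has_pole_def)
  next
    case False
    have "is_pole (\<lambda>z. flat R (1 / z) $ i $ j) (1 / \<mu>)"
    proof (rule is_pole_compose[OF pole])
      have "(\<lambda>z. 1 / z) \<midarrow>1 / \<mu>\<rightarrow> 1 / (1 / \<mu>)" using False by (intro tendsto_intros) auto
      thus "(\<lambda>z. 1 / z) \<midarrow>1 / \<mu>\<rightarrow> \<mu>" by simp
      have "\<forall>\<^sub>F z in at (1 / \<mu>). z \<noteq> 1 / \<mu>" by (rule eventually_neq_at_within)
      thus "\<forall>\<^sub>F z in at (1 / \<mu>). 1 / z \<noteq> \<mu>" by eventually_elim auto
    qed
    hence "has_pole R (1 / \<mu>)" by (auto simp: has_pole_def flat_def)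
    moreover have "1 / \<mu> \<notin> ball 0 1" using \<mu> False by (auto simp: norm_divide field_simps)
    ultimately show ?thesis by blast
  qed
  have 2: "\<forall>z\<in>cball 0 1. \<not> has_pole R z"
  proof
    fix z :: complex assume z: "z \<in> cball 0 1"
    have "(\<lambda>w. R w $ i $ j) analytic_on {z}" for i j
      by (rule analytic_on_subset[OF R]) (use z in auto)
    thus "\<not> has_pole R z" unfolding has_pole_def using analytic_at_imp_no_pole by blast
  qed
  show ?thesis unfolding mcmillan_degree_def if_not_P[OF 1] if_P[OF 2] ..
qed

lemma is_pole_quotient_blaschke_prod:
  assumes L: "set_mset L \<subseteq> ball 0 1" and N: "N analytic_on cball 0 1" and X: "finite X"
    and f: "\<And>z. z \<in> ball 0 1 - X \<Longrightarrow> f z = N z / blaschke_prod L z"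
    and \<mu>: "\<mu> \<in># L" "N \<mu> \<noteq> 0"
  shows "is_pole f \<mu>"
proof -
  have b: "\<mu> \<in> ball 0 1" using L \<mu> by auto
  have c: "\<mu> \<in> cball 0 1" using b by auto
  have "N analytic_on {\<mu>}" "blaschke_prod L analytic_on {\<mu>}"
    using c by (auto intro: analytic_on_subset[OF N] analytic_on_subset[OF blaschke_prod_analytic[OF L]])
  hence cont: "isCont N \<mu>" "isCont (blaschke_prod L) \<mu>" using analytic_at_imp_isCont by blast+
  have z: "blaschke_prod L \<mu> = 0" using blaschke_prod_zero_iff[OF L c] \<mu> by simp
  have ev: "\<forall>\<^sub>F z in at \<mu>. z \<in> ball 0 1 - (X \<union> set_mset L)"
    using X b by (intro eventually_not_in_finite) auto
  have "is_pole (\<lambda>z. N z / blaschke_prod L z) \<mu>"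
  proof (rule is_pole_divide[OF cont(1) _ \<mu>(2)])
    have "\<forall>\<^sub>F z in at \<mu>. blaschke_prod L z \<noteq> 0"
      using ev by eventually_elim (use blaschke_prod_zero_iff[OF L] in auto)
    thus "filterlim (blaschke_prod L) (at 0) (at \<mu>)"
      using cont(2) z by (simp add: filterlim_at isCont_def)
  qed
  moreover have "\<forall>\<^sub>F z in at \<mu>. N z / blaschke_prod L z = f z"
    using ev by eventually_elim (use f in auto)
  ultimately show ?thesis by (rule is_pole_transform[OF _ _ refl])
qed

section \<open>Zeros and reflection of Blaschke products\<close>

lemma zorder_blaschke_factor:
  assumes "\<mu> \<in> ball 0 1" "w \<in> ball 0 1"
  shows "zorder (blaschke_factor \<mu>) w = (if w = \<mu> then 1 else 0)"
proof (cases "w = \<mu>")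
  case False
  have "blaschke_factor \<mu> analytic_on {w}"
    by (rule analytic_on_subset[OF blaschke_factor_analytic[OF assms(1)]]) (use assms in auto)
  moreover have "blaschke_factor \<mu> w \<noteq> 0" using blaschke_factor_zero_iff[of \<mu> w] assms False by auto
  ultimately show ?thesis using False by (simp add: zorder_eq_0I)
next
  case True
  have nz: "1 - cnj \<mu> * z \<noteq> 0" if "z \<in> ball 0 1" for z
    using blaschke_factor_denom_nonzero[OF assms(1), of z] that by auto
  have "zorder (blaschke_factor \<mu>) \<mu> = 1"
  proof (rule zorder_eqI[where g = "\<lambda>z. - 1 / (1 - cnj \<mu> * z)" and S = "ball 0 1"])
    show "(\<lambda>z. - 1 / (1 - cnj \<mu> * z)) holomorphic_on ball 0 1"
      using nz by (intro holomorphic_intros) auto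
    show "blaschke_factor \<mu> z = - 1 / (1 - cnj \<mu> * z) * (z - \<mu>) powi 1" for z
      by (simp add: blaschke_factor_def diff_divide_distrib)
    show "- 1 / (1 - cnj \<mu> * \<mu>) \<noteq> 0" using nz[OF assms(1)] by simp
  qed (use assms in auto)
  thus ?thesis using True by simp
qed

lemma zorder_blaschke_prod:
  assumes L: "set_mset L \<subseteq> ball 0 1" and w: "w \<in> ball 0 1"
  shows "zorder (blaschke_prod L) w = int (count L w)"
  using L
proof (induction L)
  case empty
  have "zorder (\<lambda>_. 1 :: complex) w = 0" by (rule zorder_eq_0I) (auto simp: analytic_on_const)
  thus ?case by (simp add: blaschke_prod_def[abs_def])
next
  case (add \<mu> L)
  have \<mu>: "\<mu> \<in> ball 0 1" and L: "set_mset L \<subseteq> ball 0 1" using add.prems by auto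
  have "\<forall>\<^sub>F z in at w. z \<in> ball 0 1 - set_mset (add_mset \<mu> L)"
    by (rule eventually_not_in_finite) (use w in auto)
  hence ev: "\<forall>\<^sub>F z in at w. blaschke_factor \<mu> z * blaschke_prod L z \<noteq> 0"
    by eventually_elim (use blaschke_prod_zero_iff[OF add.prems] in auto)
  have "zorder (\<lambda>z. blaschke_factor \<mu> z * blaschke_prod L z) w = zorder (blaschke_factor \<mu>) w
      + zorder (blaschke_prod L) w"
    by (rule zorder_times_analytic[OF _ _ ev])
       (use w in \<open>auto intro: analytic_on_subset[OF blaschke_factor_analytic[OF \<mu>]] analytic_on_subset[OF blaschke_prod_analytic[OF L]]\<close>)
  thus ?case using add.IH[OF L] zorder_blaschke_factor[OF \<mu> w]
    by (simp add: blaschke_prod_add_mset[abs_def])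
qed

text \<open>
  The value at \<open>w0\<close> excludes the zero function, for which \<open>zorder\<close> is meaningless.
\<close>

lemma divide_by_blaschke_prod:
  assumes "set_mset L \<subseteq> ball 0 1" "f analytic_on cball 0 1" "w0 \<in> ball 0 1" "f w0 \<noteq> 0"
    and "\<And>w. w \<in># L \<Longrightarrow> zorder f w \<ge> int (count L w)"
  shows "\<exists>h. h analytic_on cball 0 1 \<and> (\<forall>z\<in>cball 0 1. f z = blaschke_prod L z * h z)"
  using assms(1,2,4,5)
proof (induction L arbitrary: f)
  case empty
  thus ?case by (intro exI[of _ f]) simp
next
  case (add \<mu> L)
  have \<mu>: "\<mu> \<in> ball 0 1" and L: "set_mset L \<subseteq> ball 0 1" using add.prems by auto
  have an: "g analytic_on {w}" if "g analytic_on cball 0 1" "w \<in> ball 0 1" for g w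
    by (rule analytic_on_subset[OF that(1)]) (use that(2) in auto)
  \<comment> \<open>By the identity theorem the zeros of \<open>f\<close> are isolated.\<close>
  have ev: "\<forall>\<^sub>F z in at w. f z \<noteq> 0" if "w \<in> ball 0 1" for w
  proof -
    have "f holomorphic_on ball 0 1"
      using analytic_imp_holomorphic[OF add.prems(2)] holomorphic_on_subset ball_subset_cball by blast
    from non_zero_neighbour_alt[OF this open_ball connected_ball that assms(3) add.prems(3)]
    show ?thesis by eventually_elim simp
  qed
  have "zorder f \<mu> > 0" using add.prems(4)[of \<mu>] by simp
  hence "f \<mu> = 0"
    using zorder_pos_iff'[OF an[OF add.prems(2) \<mu>]] eventually_frequently[OF _ ev[OF \<mu>]] by simp
  then obtain g where g: "g analytic_on cball 0 1" and fg: "\<And>z. z \<in> cball 0 1 \<Longrightarrow> f z = blaschke_factor \<mu> z * g z"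
    by (rule divide_by_blaschke_factor[OF add.prems(2) ball_subset_cball order_refl \<mu>]) blast
  have "zorder g w \<ge> int (count L w)" if w: "w \<in># L" for w
  proof -
    have wb: "w \<in> ball 0 1" using w L by auto
    have evb: "\<forall>\<^sub>F z in at w. z \<in> ball 0 1" using wb by (intro eventually_at_in_open') auto
    have eq: "\<forall>\<^sub>F z in at w. f z = blaschke_factor \<mu> z * g z"
      using evb by eventually_elim (rule fg, auto)
    have "\<forall>\<^sub>F z in at w. blaschke_factor \<mu> z * g z \<noteq> 0"
      using eq ev[OF wb] by eventually_elim simp
    hence "zorder (\<lambda>z. blaschke_factor \<mu> z * g z) w = zorder (blaschke_factor \<mu>) w + zorder g w"
      by (intro zorder_times_analytic an g blaschke_factor_analytic \<mu> wb)
    moreover have "zorder f w = zorder (\<lambda>z. blaschke_factor \<mu> z * g z) w"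
      by (rule zorder_cong[OF eq refl])
    ultimately show ?thesis using add.prems(4)[of w] w zorder_blaschke_factor[OF \<mu> wb]
      by (auto split: if_splits)
  qed
  moreover have "g w0 \<noteq> 0" using fg[of w0] assms(3) add.prems(3) by auto
  ultimately obtain h where h: "h analytic_on cball 0 1" "\<forall>z\<in>cball 0 1. g z = blaschke_prod L z * h z"
    using add.IH[OF L g] by blast
  thus ?case using fg by (intro exI[of _ h]) (simp add: mult.assoc)
qed

lemma finite_blaschke_product_mset:
  assumes "finite_blaschke_product d f"
  obtains c L where "cmod c = 1" "size L = d" "set_mset L \<subseteq> ball 0 1" "f = (\<lambda>z. c * blaschke_prod L z)"
proof -
  obtain c \<mu> where c: "cmod c = 1" "\<forall>j\<in>{1..d}. \<mu> j \<in> ball 0 1"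
    "f = (\<lambda>z. c * (\<Prod>j=1..d. blaschke_factor (\<mu> j) z))"
    using assms by (auto simp: finite_blaschke_product_def)
  let ?L = "image_mset \<mu> (mset_set {1..d})"
  have "blaschke_prod ?L z = (\<Prod>j=1..d. blaschke_factor (\<mu> j) z)" for z
    by (simp add: blaschke_prod_def prod_unfold_prod_mset image_mset.compositionality comp_def)
  thus thesis using c by (intro that[of c ?L]) auto
qed

text \<open>
  Reflection in the circle. It also holds where a denominator vanishes, because \<open>x / 0 = 0\<close>.
\<close>

lemma blaschke_prod_inverse:
  assumes "z \<noteq> 0"
  shows "blaschke_prod L (1 / z) = 1 / blaschke_prod (image_mset cnj L) z"
proof (induction L)
  case (add \<mu> L)
  have "blaschke_factor \<mu> (1 / z) = 1 / blaschke_factor (cnj \<mu>) z"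
  proof -
    have "\<mu> - 1 / z = (\<mu> * z - 1) / z" "1 - cnj \<mu> * (1 / z) = (z - cnj \<mu>) / z"
      using assms by (simp_all add: field_simps)
    hence "blaschke_factor \<mu> (1 / z) = (\<mu> * z - 1) / (z - cnj \<mu>)"
      using assms by (simp add: blaschke_factor_def)
    also have "\<dots> = (1 - \<mu> * z) / (cnj \<mu> - z)"
      by (metis minus_diff_eq minus_divide_divide)
    finally show ?thesis by (simp add: blaschke_factor_def)
  qed
  thus ?case using add by simp
qed simp

lemma blaschke_prod_cnj: "blaschke_prod (image_mset cnj L) (cnj z) = cnj (blaschke_prod L z)"
  by (induction L) (auto simp: blaschke_factor_def)

section \<open>The poles of the matrix \<open>\<Psi>\<close>\<close>

text \<open>
  The terms are arranged as products of \<open>B\<^sub>i\<close> and \<open>1 / B\<^sub>i\<close>, so that rationality is immediate even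
  at points where some \<open>B\<^sub>i\<close> vanishes and the fractions do not cancel.
\<close>

lemma Psi_entries:
  "Psi B0 B1 B2 a s z $ 1 $ 1 = 1 / B0 z * (B0 z * (1 / B1 z)) * (1 / B0 z)
      + (- (of_real a)\<^sup>2) * of_real s * (B2 z * (1 / B0 z))"
  "Psi B0 B1 B2 a s z $ 1 $ 2 = 1 / B0 z * (B0 z * (1 / B1 z)) * of_real a
      + of_real a * of_real s * (B2 z * (1 / B0 z)) * B0 z"
  "Psi B0 B1 B2 a s z $ 2 $ 1 = (- of_real a) * (B0 z * (1 / B1 z)) * (1 / B0 z)
      + (- of_real a) * of_real s * B0 z * (B2 z * (1 / B0 z))"
  "Psi B0 B1 B2 a s z $ 2 $ 2 = (- (of_real a)\<^sup>2) * (B0 z * (1 / B1 z))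
      + of_real s * B0 z * (B2 z * (1 / B0 z)) * B0 z"
  by (simp_all add: Psi_def Let_def matrix_matrix_mult_def sum_2 power2_eq_square divide_inverse mult_ac)

lemma Psi_entries_nonzero:
  assumes "B0 z \<noteq> 0" "B1 z \<noteq> 0"
  shows "Psi B0 B1 B2 a s z $ 1 $ 1 = (1 - of_real (s * a\<^sup>2) * B1 z * B2 z) / (B0 z * B1 z)"
    "Psi B0 B1 B2 a s z $ 1 $ 2 = of_real a * (1 / B1 z + of_real s * B2 z)"
    "Psi B0 B1 B2 a s z $ 2 $ 1 = - of_real a * (1 / B1 z + of_real s * B2 z)"
    "Psi B0 B1 B2 a s z $ 2 $ 2 = B0 z * (- (of_real a)\<^sup>2 / B1 z + of_real s * B2 z)"
proof -
  have "1 / B0 z * (B0 z * (1 / B1 z)) * (1 / B0 z) = 1 / (B0 z * B1 z)" using assms by simp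
  moreover have "(1 - of_real (s * a\<^sup>2) * B1 z * B2 z) / (B0 z * B1 z)
      = 1 / (B0 z * B1 z) - of_real (s * a\<^sup>2) * (B2 z / B0 z)"
    using assms by (simp add: diff_divide_distrib)
  ultimately show "Psi B0 B1 B2 a s z $ 1 $ 1 = (1 - of_real (s * a\<^sup>2) * B1 z * B2 z) / (B0 z * B1 z)"
    unfolding Psi_entries by simp
  have 1: "1 / B0 z * (B0 z * (1 / B1 z)) * x = 1 / B1 z * x" "B0 z * (1 / B1 z) * (1 / B0 z) = 1 / B1 z" for x
    using assms by simp_all
  have 2: "x * (B2 z * (1 / B0 z)) * B0 z = x * B2 z" "x * B0 z * (B2 z * (1 / B0 z)) = x * B2 z" for x
    using assms by simp_all
  show "Psi B0 B1 B2 a s z $ 1 $ 2 = of_real a * (1 / B1 z + of_real s * B2 z)"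
    unfolding Psi_entries 1 2 by (simp only: distrib_left mult_ac)
  show "Psi B0 B1 B2 a s z $ 2 $ 1 = - of_real a * (1 / B1 z + of_real s * B2 z)"
    unfolding Psi_entries mult.assoc[of "- of_real a" "B0 z * (1 / B1 z)"] 1 2
    by (simp only: distrib_left mult_ac)
  show "Psi B0 B1 B2 a s z $ 2 $ 2 = B0 z * (- (of_real a)\<^sup>2 / B1 z + of_real s * B2 z)"
    unfolding Psi_entries 2 by (simp only: distrib_left mult_ac divide_inverse mult_1_left)
qed

lemma circle_rational_Psi:
  assumes "circle_rational B0" "circle_rational B1" "circle_rational B2"
    "circle_rational (\<lambda>z. 1 / B0 z)" "circle_rational (\<lambda>z. 1 / B1 z)"
  shows "circle_rational (\<lambda>z. Psi B0 B1 B2 a s z $ i $ j)"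
  using exhaust_2[of i] exhaust_2[of j]
  by (elim disjE) (simp_all only: Psi_entries, (intro circle_rational_add circle_rational_mult circle_rational_const assms)+)

text \<open>
  The determinant of \<open>q \<Psi>\<close> is \<open>q\<close> times the analytic function \<open>q det \<Psi>\<close>. Here \<open>x\<close> is the Blaschke product
  of the zeros of \<open>B\<^sub>1\<close>, \<open>y\<close> stands for \<open>B\<^sub>2\<close>, and \<open>u\<close> and \<open>p\<close> are the products of the cancelled and the
  remaining zeros of \<open>B\<^sub>0\<close>, so that \<open>q = p x\<close>.
\<close>

lemma numerator_det_inside:
  fixes c0 c1 h p u x y a s :: complex
  assumes c: "c0 \<noteq> 0" "c1 \<noteq> 0" and uh: "1 - s * a\<^sup>2 * (c1 * x) * y = u * h"
  shows "h / (c0 * c1) * (p * (c0 * (u * p)) * (- a\<^sup>2 / c1 + s * (x * y)))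
      - a * p * (1 / c1 + s * (x * y)) * (- a * p * (1 / c1 + s * (x * y)))
    = p * x * (s * (1 + a\<^sup>2)\<^sup>2 / c1 * p * y)"
proof -
  define e where "e = 1 / c1"
  have e: "c1 * e = 1" using c by (simp add: e_def)
  have "h / (c0 * c1) * (p * (c0 * (u * p)) * w) = p^2 * e * (u * h) * w" for w
    using c by (simp add: e_def power2_eq_square)
  moreover have "p^2 * e * (1 - s * a\<^sup>2 * (c1 * x) * y) * (- a\<^sup>2 * e + s * (x * y))
      - a * p * (e + s * (x * y)) * (- a * p * (e + s * (x * y)))
    = p * x * (s * (1 + a\<^sup>2)\<^sup>2 * e * p * y)"
    using e by algebra
  ultimately show ?thesis unfolding uh by (simp add: e_def)
qed

lemma pull_out_denominator:
  fixes b c s x y :: complex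
  assumes "c \<noteq> 0" "x \<noteq> 0"
  shows "b / (c * x) + s * y = (b / c + s * (x * y)) / x"
  using assms by (simp add: add_divide_distrib)

text \<open>
  Here \<open>c\<^sub>i / x\<^sub>i\<close> is the value of \<open>B\<^sub>i\<close> at \<open>1 / z\<close>. All entries of the reflected matrix are brought to
  the denominator \<open>q = x\<^sub>0 x\<^sub>2\<close>.
\<close>

lemma reflected_entries:
  fixes a b s w c0 c1 c2 x0 x1 x2 :: complex
  assumes "c0 \<noteq> 0" "c1 \<noteq> 0" "x0 \<noteq> 0" "x1 \<noteq> 0" "x2 \<noteq> 0"
  shows "(1 - w * (c1 / x1) * (c2 / x2)) / (c0 / x0 * (c1 / x1))
      = x0 * x0 * (x1 * x2 - w * c1 * c2) / (c0 * c1) / (x0 * x2)"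
    "a * (1 / (c1 / x1) + s * (c2 / x2)) = a * x0 * (x1 * x2 / c1 + s * c2) / (x0 * x2)"
    "c0 / x0 * (- b / (c1 / x1) + s * (c2 / x2)) = c0 * (- b * (x1 * x2) / c1 + s * c2) / (x0 * x2)"
proof -
  define v where "v = x1 * x2 - w * c1 * c2"
  have "1 - w * (c1 / x1) * (c2 / x2) = v / (x1 * x2)"
    using assms by (simp add: v_def diff_divide_distrib)
  moreover have "v / (x1 * x2) / (c0 / x0 * (c1 / x1)) = x0 * x0 * v / (c0 * c1) / (x0 * x2)"
    using assms by (simp add: mult_ac)
  ultimately show "(1 - w * (c1 / x1) * (c2 / x2)) / (c0 / x0 * (c1 / x1))
      = x0 * x0 * (x1 * x2 - w * c1 * c2) / (c0 * c1) / (x0 * x2)"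
    by (simp only: v_def)
  have c: "y * (u / x2) = y * x0 * u / (x0 * x2)" "y / x0 * (u / x2) = y * u / (x0 * x2)" for y u
    using assms by simp_all
  have "1 / (c1 / x1) + s * (c2 / x2) = (x1 * x2 / c1 + s * c2) / x2"
    using assms by (simp add: add_divide_distrib)
  thus "a * (1 / (c1 / x1) + s * (c2 / x2)) = a * x0 * (x1 * x2 / c1 + s * c2) / (x0 * x2)"
    by (simp only: c(1))
  have "- b / (c1 / x1) + s * (c2 / x2) = (- b * (x1 * x2) / c1 + s * c2) / x2"
    using assms by (simp add: diff_divide_distrib add_divide_distrib)
  thus "c0 / x0 * (- b / (c1 / x1) + s * (c2 / x2)) = c0 * (- b * (x1 * x2) / c1 + s * c2) / (x0 * x2)"
    by (simp only: c(2))
qed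

text \<open>
  The counterpart of the preceding determinant for the reflected matrix.
\<close>

lemma numerator_det_outside:
  fixes a s c0 c1 c2 x0 x1 x2 :: complex
  assumes "c0 \<noteq> 0" "c1 \<noteq> 0"
  shows "x0 * x0 * (x1 * x2 - s * a\<^sup>2 * c1 * c2) / (c0 * c1) * (c0 * (- a\<^sup>2 * (x1 * x2) / c1 + s * c2))
      - a * x0 * (x1 * x2 / c1 + s * c2) * (- a * x0 * (x1 * x2 / c1 + s * c2))
    = x0 * x2 * (s * (1 + a\<^sup>2)\<^sup>2 * c2 / c1 * x0 * x1)"
proof -
  define e where "e = 1 / c1"
  have e: "c1 * e = 1" using assms by (simp add: e_def)
  have "x0 * x0 * (x1 * x2 - s * a\<^sup>2 * c1 * c2) / (c0 * c1) * (c0 * (- a\<^sup>2 * (x1 * x2) / c1 + s * c2))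
    = x0 * x0 * (x1 * x2 - s * a\<^sup>2 * c1 * c2) * e * (- a\<^sup>2 * (x1 * x2) * e + s * c2)"
    using assms(1) by (simp add: e_def)
  moreover have "x0 * x0 * (x1 * x2 - s * a\<^sup>2 * c1 * c2) * e * (- a\<^sup>2 * (x1 * x2) * e + s * c2)
      - a * x0 * (x1 * x2 * e + s * c2) * (- a * x0 * (x1 * x2 * e + s * c2))
    = x0 * x2 * (s * (1 + a\<^sup>2)\<^sup>2 * c2 * e * x0 * x1)"
    using e by algebra
  ultimately show ?thesis by (simp add: e_def)
qed

text \<open>
  \<open>Lr\<close> is the part of the zeros of \<open>B\<^sub>0\<close> that cancels against \<open>1 - s a\<^sup>2 B\<^sub>1 B\<^sub>2\<close>, and \<open>L'\<close> the part that
  does not. The last hypothesis says that \<open>- a\<^sup>2 / B\<^sub>1 + s B\<^sub>2\<close> does not vanish at the reflections of the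
  zeros of \<open>B\<^sub>0\<close>.
\<close>

lemma degrees_Psi:
  fixes a s :: real and c0 c1 c2 :: complex and L0 L1 L2 :: "complex multiset"
  defines "B0 \<equiv> (\<lambda>z. c0 * blaschke_prod L0 z)" and "B1 \<equiv> (\<lambda>z. c1 * blaschke_prod L1 z)"
    and "B2 \<equiv> (\<lambda>z. c2 * blaschke_prod L2 z)"
  assumes c: "c0 \<noteq> 0" "c1 \<noteq> 0" "c2 \<noteq> 0"
    and L: "set_mset L0 \<subseteq> ball 0 1" "set_mset L1 \<subseteq> ball 0 1" "set_mset L2 \<subseteq> ball 0 1"
    and s: "s \<noteq> 0"
    and L0: "L0 = Lr + L'"
    and H: "H analytic_on cball 0 1"
      "\<And>z. z \<in> cball 0 1 \<Longrightarrow> 1 - of_real (s * a\<^sup>2) * B1 z * B2 z = blaschke_prod Lr z * H z"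
    and H_nz: "\<And>\<mu>. \<mu> \<in># L' \<Longrightarrow> H \<mu> \<noteq> 0"
    and ne: "L0 \<noteq> {#}"
    and reflected: "\<And>\<mu>. \<mu> \<in># L0 \<Longrightarrow> of_real (a\<^sup>2) * cnj (blaschke_prod L1 \<mu> * blaschke_prod L2 \<mu>) \<noteq> of_real s * c1 * c2"
  shows "deg_minus (Psi B0 B1 B2 a s) = size L' + size L1"
    and "deg_plus (Psi B0 B1 B2 a s) = size L0 + size L2"
proof -
  let ?\<Psi> = "Psi B0 B1 B2 a s"
  note cr = circle_rational_blaschke_prod
  have inv: "circle_rational (\<lambda>z. 1 / (e * blaschke_prod K z))" if "set_mset K \<subseteq> ball 0 1" for e K
  proof -
    have "circle_rational (\<lambda>z. (1 / e) * (1 / blaschke_prod K z))"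
      by (intro circle_rational_mult circle_rational_const cr that)
    thus ?thesis by simp
  qed
  have "circle_rational (\<lambda>z. ?\<Psi> z $ i $ j)" for i j
  proof (rule circle_rational_Psi)
    show "circle_rational B0" "circle_rational B1" "circle_rational B2"
      unfolding B0_def B1_def B2_def by (intro circle_rational_mult circle_rational_const cr L)+
    show "circle_rational (\<lambda>z. 1 / B0 z)" "circle_rational (\<lambda>z. 1 / B1 z)"
      unfolding B0_def B1_def by (intro inv L)+
  qed
  then obtain R S A X where RS: "rational_extension (riesz_plus ?\<Psi>) = R" "rational_extension (riesz_minus ?\<Psi>) = S"
    and R: "\<And>i j. (\<lambda>z. R z $ i $ j) analytic_on cball 0 1" and S: "\<And>i j. (\<lambda>z. S z $ i $ j) analytic_on - ball 0 1"
    and A: "\<And>i j. (\<lambda>z. A z $ i $ j) analytic_on cball 0 1"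
    and SA: "\<And>z i j. z \<in> cball 0 1 - {0} \<Longrightarrow> S (1 / z) $ i $ j = z * A z $ i $ j"
    and X: "finite X" and \<Psi>: "\<And>z i j. z \<notin> X \<Longrightarrow> ?\<Psi> z $ i $ j = R z $ i $ j + S z $ i $ j"
    by (rule riesz_matrix_decomposition[of ?\<Psi>]) blast
  have nz: "blaschke_prod K z \<noteq> 0" if "set_mset K \<subseteq> ball 0 1" "z \<in> ball 0 1" "z \<notin># K" for K z
    using blaschke_prod_zero_iff[OF that(1), of z] that(2,3) by auto
  note an = analytic_on_mult analytic_on_add analytic_on_diff analytic_on_const blaschke_prod_analytic L

  show "deg_minus ?\<Psi> = size L' + size L1"
  proof -
    let ?L = "L' + L1"
    have LL: "set_mset ?L \<subseteq> ball 0 1" "set_mset L' \<subseteq> ball 0 1" using L L0 by auto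
    \<comment> \<open>\<open>M = q \<Psi>\<close>, where \<open>q\<close> has the uncancelled zeros of \<open>B\<^sub>0\<close> and the zeros of \<open>B\<^sub>1\<close>; at a
      zero of \<open>B\<^sub>1\<close> the first entry cannot vanish, because \<open>1 - s a\<^sup>2 B\<^sub>1 B\<^sub>2 = 1\<close> there.\<close>
    define M where "M z = (vector [vector [H z / (c0 * c1), of_real a * blaschke_prod L' z * (1 / c1
        + of_real s * (blaschke_prod L1 z * B2 z))],
      vector [- of_real a * blaschke_prod L' z * (1 / c1 + of_real s * (blaschke_prod L1 z * B2 z)),
        blaschke_prod L' z * B0 z * (- (of_real a)\<^sup>2 / c1
            + of_real s * (blaschke_prod L1 z * B2 z))]] :: complex^2^2)" for z
    have M: "M z $ 1 $ 1 = H z / (c0 * c1)"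
      "M z $ 1 $ 2 = of_real a * blaschke_prod L' z * (1 / c1 + of_real s * (blaschke_prod L1 z * B2 z))"
      "M z $ 2 $ 1 = - of_real a * blaschke_prod L' z * (1 / c1 + of_real s * (blaschke_prod L1 z * B2 z))"
      "M z $ 2 $ 2 = blaschke_prod L' z * B0 z * (- (of_real a)\<^sup>2 / c1
          + of_real s * (blaschke_prod L1 z * B2 z))" for z
      by (simp_all add: M_def)
    have "inner_degree S = size ?L"
    proof (rule inner_degree_eq_size_mod_analytic[OF LL(1) _ R, where M = M and r = 1 and c = 1 and X =
        "X \<union> set_mset (L0 + L1)"
          and E = "\<lambda>z. of_real s * (1 + (of_real a)\<^sup>2)\<^sup>2 / c1 * blaschke_prod L' z * B2 z"])
      show "(\<lambda>z. M z $ i $ j) analytic_on cball 0 1" for i j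
        using exhaust_2[of i] exhaust_2[of j]
        by (elim disjE) (simp_all only: M B0_def B2_def divide_inverse, (intro an LL(2) H(1))+)
      show "(\<lambda>z. of_real s * (1 + (of_real a)\<^sup>2)\<^sup>2 / c1 * blaschke_prod L' z * B2 z) analytic_on cball 0 1"
        unfolding B2_def by (intro an LL(2))
      show "det (M z) = blaschke_prod ?L z * (of_real s * (1 + (of_real a)\<^sup>2)\<^sup>2 / c1 * blaschke_prod L' z * B2 z)"
        if z: "z \<in> cball 0 1" for z
      proof -
        have "1 - of_real s * (of_real a)\<^sup>2 * (c1 * blaschke_prod L1 z) * B2 z = blaschke_prod Lr z * H z"
          using H(2)[OF z] by (simp add: B1_def)
        from numerator_det_inside[OF c(1,2) this] show ?thesis
          unfolding det_2 M B0_def L0 blaschke_prod_union .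
      qed
      show "M \<mu> $ 1 $ 1 \<noteq> 0" if "\<mu> \<in># ?L" for \<mu>
      proof (cases "\<mu> \<in># L'")
        case False
        hence "\<mu> \<in># L1" using that by auto
        hence "blaschke_prod L1 \<mu> = 0" and "\<mu> \<in> cball 0 1" using blaschke_prod_zero_iff[OF L(2), of \<mu>] L(2) by auto
        hence "H \<mu> \<noteq> 0" using H(2)[of \<mu>] by (auto simp: B1_def)
        thus ?thesis using c by (simp add: M)
      qed (use H_nz c in \<open>auto simp: M\<close>)
      show "finite (X \<union> set_mset (L0 + L1))" using X by simp
      fix z i j assume z: "z \<in> ball 0 1 - (X \<union> set_mset (L0 + L1))"
      have n: "blaschke_prod Lr z \<noteq> 0" "blaschke_prod L' z \<noteq> 0" "blaschke_prod L1 z \<noteq> 0"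
        by (rule nz; use z L L0 in auto)+
      have B: "B0 z \<noteq> 0" "B1 z \<noteq> 0" using n c by (auto simp: B0_def B1_def L0)
      have "?\<Psi> z $ i $ j = M z $ i $ j / blaschke_prod ?L z"
      proof -
        have "1 - of_real (s * a\<^sup>2) * B1 z * B2 z = blaschke_prod Lr z * H z" using H(2) z by simp
        hence "(1 - of_real (s * a\<^sup>2) * B1 z * B2 z) / (B0 z * B1 z) = blaschke_prod Lr z * H z / (B0 z * B1 z)"
          by (rule arg_cong)
        also have "\<dots> = H z / (c0 * c1) / blaschke_prod ?L z"
          using n c by (simp add: B0_def B1_def L0 field_simps)
        finally have "(1 - of_real (s * a\<^sup>2) * B1 z * B2 z) / (B0 z * B1 z) = H z / (c0 * c1) / blaschke_prod ?L z" .
        hence "?\<Psi> z $ 1 $ 1 = M z $ 1 $ 1 / blaschke_prod ?L z"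
          unfolding Psi_entries_nonzero(1)[of B0 z B1, OF B] M .
        moreover have "1 / B1 z + of_real s * B2 z = (1 / c1
            + of_real s * (blaschke_prod L1 z * B2 z)) / blaschke_prod L1 z"
          unfolding B1_def by (rule pull_out_denominator) (use n c in auto)
        hence "?\<Psi> z $ 1 $ 2 = M z $ 1 $ 2 / blaschke_prod ?L z" "?\<Psi> z $ 2 $ 1 = M z $ 2 $ 1 / blaschke_prod ?L z"
          unfolding Psi_entries_nonzero(2,3)[of B0 z B1, OF B] M blaschke_prod_union using n by simp_all
        moreover have "- (of_real a)\<^sup>2 / B1 z + of_real s * B2 z = (- (of_real a)\<^sup>2 / c1
            + of_real s * (blaschke_prod L1 z * B2 z)) / blaschke_prod L1 z"
          unfolding B1_def by (rule pull_out_denominator) (use n c in auto)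
        hence "?\<Psi> z $ 2 $ 2 = M z $ 2 $ 2 / blaschke_prod ?L z"
          unfolding Psi_entries_nonzero(4)[of B0 z B1, OF B] M blaschke_prod_union using n by simp
        ultimately have "\<forall>i j. ?\<Psi> z $ i $ j = M z $ i $ j / blaschke_prod ?L z"
          unfolding forall_2 by blast
        thus ?thesis by blast
      qed
      thus "S z $ i $ j = M z $ i $ j / blaschke_prod ?L z - R z $ i $ j"
        using \<Psi>[of z i j] z by (simp add: algebra_simps)
    qed
    thus ?thesis unfolding deg_minus_def RS(2) using mcmillan_degree_poles_in_disk[OF S A SA] by simp
  qed

  show "deg_plus ?\<Psi> = size L0 + size L2"
  proof -
    define x0 x1 x2 where "x0 = blaschke_prod (image_mset cnj L0)" and "x1 = blaschke_prod (image_mset cnj L1)"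
      and "x2 = blaschke_prod (image_mset cnj L2)"
    have cL: "set_mset (image_mset cnj K) \<subseteq> ball 0 1" if "set_mset K \<subseteq> ball 0 1" for K using that by auto
    have xa: "x0 analytic_on cball 0 1" "x1 analytic_on cball 0 1" "x2 analytic_on cball 0 1"
      unfolding x0_def x1_def x2_def by (intro blaschke_prod_analytic cL L)+
    let ?L = "image_mset cnj (L0 + L2)"
    have LL: "set_mset ?L \<subseteq> ball 0 1" using L by auto
    have q: "blaschke_prod ?L z = x0 z * x2 z" for z by (simp add: x0_def x2_def)
    \<comment> \<open>\<open>M(z) = q(z) \<Psi>(1/z)\<close>\<close>
    define M where "M z = (vector [vector [x0 z * x0 z * (x1 z * x2 z - of_real (s * a\<^sup>2) * c1 * c2) / (c0 * c1),
        of_real a * x0 z * (x1 z * x2 z / c1 + of_real s * c2)],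
      vector [- of_real a * x0 z * (x1 z * x2 z / c1 + of_real s * c2),
        c0 * (- (of_real a)\<^sup>2 * (x1 z * x2 z) / c1 + of_real s * c2)]] :: complex^2^2)" for z
    have M: "M z $ 1 $ 1 = x0 z * x0 z * (x1 z * x2 z - of_real (s * a\<^sup>2) * c1 * c2) / (c0 * c1)"
      "M z $ 1 $ 2 = of_real a * x0 z * (x1 z * x2 z / c1 + of_real s * c2)"
      "M z $ 2 $ 1 = - of_real a * x0 z * (x1 z * x2 z / c1 + of_real s * c2)"
      "M z $ 2 $ 2 = c0 * (- (of_real a)\<^sup>2 * (x1 z * x2 z) / c1 + of_real s * c2)" for z
      by (simp_all add: M_def)
    define Z where "Z z = (\<chi> i j. z * A z $ i $ j :: complex^2^2)" for z
    have Z: "Z z $ i $ j = z * A z $ i $ j" for z i j by (simp add: Z_def)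
    have Ma: "(\<lambda>z. M z $ i $ j) analytic_on cball 0 1" for i j
      using exhaust_2[of i] exhaust_2[of j]
      by (elim disjE) (simp_all only: M divide_inverse, (intro an xa)+)
    have Za: "(\<lambda>z. Z z $ i $ j) analytic_on cball 0 1" for i j
      unfolding Z by (intro analytic_on_mult analytic_on_ident A)
    let ?X = "{0} \<union> (\<lambda>z. 1 / z) ` X \<union> set_mset (image_mset cnj (L0 + L1 + L2))"
    have X': "finite ?X" using X by simp
    have Mnz: "M \<nu> $ 2 $ 2 \<noteq> 0" if \<nu>: "\<nu> \<in># ?L" for \<nu>
    proof -
      from \<nu> obtain \<mu> where \<mu>: "\<nu> = cnj \<mu>" "\<mu> \<in># L0 + L2" by auto
      have x12: "x1 \<nu> * x2 \<nu> = cnj (blaschke_prod L1 \<mu> * blaschke_prod L2 \<mu>)"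
        by (simp add: \<mu>(1) x1_def x2_def blaschke_prod_cnj)
      have "of_real (a\<^sup>2) * (x1 \<nu> * x2 \<nu>) \<noteq> of_real s * c1 * c2"
      proof (cases "\<mu> \<in># L0")
        case True
        thus ?thesis using reflected x12 by simp
      next
        case False
        hence "\<mu> \<in># L2" using \<mu>(2) by simp
        hence "blaschke_prod L2 \<mu> = 0" using blaschke_prod_zero_iff[OF L(3), of \<mu>] L(3) by auto
        hence "x1 \<nu> * x2 \<nu> = 0" unfolding x12 by simp
        thus ?thesis using s c by (simp only: mult_zero_right) simp
      qed
      thus ?thesis using c by (auto simp: M field_simps)
    qed
    have flatR: "flat R z $ i $ j = M z $ i $ j / blaschke_prod ?L z - Z z $ i $ j" if z: "z \<in> ball 0 1 - ?X"
        for z i j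
    proof -
      have z0: "z \<noteq> 0" using z by auto
      have n: "x0 z \<noteq> 0" "x1 z \<noteq> 0" "x2 z \<noteq> 0"
        unfolding x0_def x1_def x2_def by (rule nz; use z L in auto)+
      have B: "B0 (1 / z) = c0 / x0 z" "B1 (1 / z) = c1 / x1 z" "B2 (1 / z) = c2 / x2 z"
        by (simp_all add: B0_def B1_def B2_def x0_def x1_def x2_def blaschke_prod_inverse[OF z0])
      have Bn: "B0 (1 / z) \<noteq> 0" "B1 (1 / z) \<noteq> 0" using B n c by auto
      have "1 / z \<notin> X"
      proof
        assume "1 / z \<in> X"
        hence "1 / (1 / z) \<in> (\<lambda>z. 1 / z) ` X" by (rule imageI)
        thus False using z by simp
      qed
      hence "?\<Psi> (1 / z) $ i $ j = flat R z $ i $ j + Z z $ i $ j"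
        using \<Psi>[of "1 / z" i j] SA[of z i j] z by (simp add: flat_def Z)
      moreover have "?\<Psi> (1 / z) $ i $ j = M z $ i $ j / blaschke_prod ?L z"
      proof -
        note E = Psi_entries_nonzero[of B0 "1 / z" B1 B2 a s, OF Bn, unfolded B reflected_entries[OF c(1,2) n]]
        have "?\<Psi> (1 / z) $ 2 $ 1 = - (?\<Psi> (1 / z) $ 1 $ 2)"
          unfolding Psi_entries_nonzero(2,3)[of B0 "1 / z" B1 B2 a s, OF Bn] by simp
        also have "\<dots> = M z $ 2 $ 1 / blaschke_prod ?L z" unfolding E(2) M q by simp
        finally have "?\<Psi> (1 / z) $ 2 $ 1 = M z $ 2 $ 1 / blaschke_prod ?L z" .
        moreover have "?\<Psi> (1 / z) $ 1 $ 1 = M z $ 1 $ 1 / blaschke_prod ?L z"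
          "?\<Psi> (1 / z) $ 1 $ 2 = M z $ 1 $ 2 / blaschke_prod ?L z" "?\<Psi> (1 / z) $ 2 $ 2
              = M z $ 2 $ 2 / blaschke_prod ?L z"
          unfolding E M q by (rule refl)+
        ultimately have "\<forall>i j. ?\<Psi> (1 / z) $ i $ j = M z $ i $ j / blaschke_prod ?L z"
          unfolding forall_2 by blast
        thus ?thesis by blast
      qed
      ultimately show ?thesis by simp
    qed
    have "inner_degree (flat R) = size ?L"
    proof (rule inner_degree_eq_size_mod_analytic[OF LL Ma Za _ _ Mnz X' flatR, where E = "\<lambda>z. of_real s * (1
        + (of_real a)\<^sup>2)\<^sup>2 * c2 / c1 * x0 z * x1 z"])
      show "(\<lambda>z. of_real s * (1 + (of_real a)\<^sup>2)\<^sup>2 * c2 / c1 * x0 z * x1 z) analytic_on cball 0 1"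
        by (intro an xa)
      show "det (M z) = blaschke_prod ?L z * (of_real s * (1 + (of_real a)\<^sup>2)\<^sup>2 * c2 / c1 * x0 z * x1 z)" for z
        unfolding q det_2 M of_real_mult of_real_power by (rule numerator_det_outside[OF c(1,2)])
    qed
    moreover have "mcmillan_degree R = inner_degree (flat R)"
    proof -
      obtain \<mu> where "\<mu> \<in># L0" using ne by blast
      hence \<nu>: "cnj \<mu> \<in># ?L" by auto
      hence b: "cnj \<mu> \<in> ball 0 1" using LL by blast
      let ?N = "\<lambda>z. M z $ 2 $ 2 - blaschke_prod ?L z * Z z $ 2 $ 2"
      have "is_pole (\<lambda>z. flat R z $ 2 $ 2) (cnj \<mu>)"
      proof (rule is_pole_quotient_blaschke_prod[OF LL _ X' _ \<nu>])
        show "?N analytic_on cball 0 1"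
          by (intro analytic_on_diff analytic_on_mult Ma Za blaschke_prod_analytic LL)
        show "flat R z $ 2 $ 2 = ?N z / blaschke_prod ?L z" if z: "z \<in> ball 0 1 - ?X" for z
        proof -
          have "blaschke_prod ?L z \<noteq> 0" using z by (intro nz LL) auto
          thus ?thesis unfolding flatR[OF z] by (simp add: diff_divide_distrib)
        qed
        have zero: "blaschke_prod ?L (cnj \<mu>) = 0" using blaschke_prod_zero_iff[OF LL, of "cnj \<mu>"] \<nu> b by auto
        show "?N (cnj \<mu>) \<noteq> 0" unfolding zero mult_zero_left diff_zero by (rule Mnz[OF \<nu>])
      qed
      thus ?thesis by (rule mcmillan_degree_poles_outside[OF R b])
    qed
    ultimately show ?thesis unfolding deg_plus_def RS(1) by simp
  qed
qed

theorem theorem4p4: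
  fixes k d :: nat and a :: real and B0 B1 B2 :: "complex \<Rightarrow> complex"
    and t :: "nat \<Rightarrow> real" and \<Delta> :: "nat \<Rightarrow> complex set" and \<kappa> :: "nat \<Rightarrow> int"
  assumes k: "k \<ge> 2" and a: "a > 1"
    and B0: "finite_blaschke_product (k - 1) B0"
    and B1: "finite_blaschke_product k B1"
    and B2: "finite_blaschke_product (k - 2) B2"
    and t_range: "\<forall>j\<in>{1..d}. t j \<in> {0<..<1}"
    and t_distinct: "inj_on t {1..d}"
    and \<Delta>_nonempty: "\<forall>j\<in>{1..d}. \<Delta> j \<noteq> {}"
    and \<Delta>_disjoint: "disjoint_family_on \<Delta> {1..d}"
    and \<Delta>_union: "(\<Union>j\<in>{1..d}. \<Delta> j) = disk_zeros B0"
    and \<kappa>: "\<forall>j\<in>{1..d}. \<kappa> j = (\<Sum>w\<in>\<Delta> j. zorder B0 w)"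
    and vanish: "\<forall>j\<in>{1..d}. \<forall>w\<in>\<Delta> j.
       1 - of_real (t j * a\<^sup>2) * B1 w * B2 w = 0 \<and>
       zorder (\<lambda>z. 1 - of_real (t j * a\<^sup>2) * B1 z * B2 z) w \<ge> zorder B0 w"
  shows "(\<forall>s\<in>{0<..1}.
            \<not> int (deg_plus (Psi B0 B1 B2 a s)) \<le> int (deg_minus (Psi B0 B1 B2 a s)) - 2
            \<longleftrightarrow> s \<in> t ` {1..d}) \<and>
         (\<forall>j\<in>{1..d}.
            int (deg_plus (Psi B0 B1 B2 a (t j))) = int (deg_minus (Psi B0 B1 B2 a (t j))) - 2 + \<kappa> j)"
proof -
  obtain c0 L0 where c0: "cmod c0 = 1" and L0: "size L0 = k - 1" "set_mset L0 \<subseteq> ball 0 1"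
    and B0': "B0 = (\<lambda>z. c0 * blaschke_prod L0 z)"
    by (rule finite_blaschke_product_mset[OF B0])
  obtain c1 L1 where c1: "cmod c1 = 1" and L1: "size L1 = k" "set_mset L1 \<subseteq> ball 0 1"
    and B1': "B1 = (\<lambda>z. c1 * blaschke_prod L1 z)"
    by (rule finite_blaschke_product_mset[OF B1])
  obtain c2 L2 where c2: "cmod c2 = 1" and L2: "size L2 = k - 2" "set_mset L2 \<subseteq> ball 0 1"
    and B2': "B2 = (\<lambda>z. c2 * blaschke_prod L2 z)"
    by (rule finite_blaschke_product_mset[OF B2])
  have c: "c0 \<noteq> 0" "c1 \<noteq> 0" "c2 \<noteq> 0" using c0 c1 c2 by auto
  have zeros: "(\<Union>j\<in>{1..d}. \<Delta> j) = set_mset L0"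
    unfolding \<Delta>_union using L0(2) c blaschke_prod_zero_iff[OF L0(2)] by (auto simp: disk_zeros_def B0')
  have ord: "zorder B0 w = int (count L0 w)" if "w \<in> ball 0 1" for w
    unfolding B0' zorder_cmult[OF c(1)] by (rule zorder_blaschke_prod[OF L0(2) that])
  have crit: "\<exists>j\<in>{1..d}. w \<in> \<Delta> j \<and> of_real (t j * a\<^sup>2) * B1 w * B2 w = 1" if w: "w \<in># L0" for w
  proof -
    from w have "w \<in> (\<Union>j\<in>{1..d}. \<Delta> j)" unfolding zeros .
    then obtain j where j: "j \<in> {1..d}" "w \<in> \<Delta> j" by blast
    hence "1 - of_real (t j * a\<^sup>2) * B1 w * B2 w = 0" using vanish by blast
    thus ?thesis using j by (intro bexI[of _ j]) auto
  qed
  have crit_iff: "of_real (s * a\<^sup>2) * B1 w * B2 w = 1 \<longleftrightarrow> s = t j"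
    if "j \<in> {1..d}" "w \<in> \<Delta> j" for s j w
  proof -
    have j: "of_real (t j) * (of_real (a\<^sup>2) * B1 w * B2 w) = 1" using vanish that by (auto simp: mult.assoc)
    define u where "u = of_real (a\<^sup>2) * B1 w * B2 w"
    have "u \<noteq> 0" using j by (auto simp: u_def)
    hence "of_real s * u = 1 \<longleftrightarrow> of_real s = (of_real (t j) :: complex)" using j unfolding u_def[symmetric]
      by (metis mult_right_cancel)
    thus ?thesis by (simp add: u_def mult.assoc)
  qed
  \<comment> \<open>The zeros of \<open>B0\<close> that are cancelled for the parameter \<open>s\<close>.\<close>
  define Lr where "Lr s = filter_mset (\<lambda>w. of_real (s * a\<^sup>2) * B1 w * B2 w = 1) L0" for s
  have degs: "deg_minus (Psi B0 B1 B2 a s) = (k - 1 - size (Lr s)) + k" "deg_plus (Psi B0 B1 B2 a s) = (k - 1)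
      + (k - 2)"
    if s: "s \<in> {0<..1}" for s
  proof -
    let ?g = "\<lambda>z. 1 - of_real (s * a\<^sup>2) * B1 z * B2 z"
    let ?L' = "filter_mset (\<lambda>w. of_real (s * a\<^sup>2) * B1 w * B2 w \<noteq> 1) L0"
    have split: "L0 = Lr s + ?L'" unfolding Lr_def by (rule multiset_partition)
    have Lr_ball: "set_mset (Lr s) \<subseteq> ball 0 1" using L0(2) by (auto simp: Lr_def)
    have ga: "?g analytic_on cball 0 1"
      unfolding B1' B2' by (intro analytic_on_diff analytic_on_mult analytic_on_const blaschke_prod_analytic L1(2) L2(2))
    \<comment> \<open>\<open>?g\<close> is not identically zero, since it equals one at the zeros of \<open>B1\<close>.\<close>
    have "L1 \<noteq> {#}" using L1(1) k by auto
    then obtain w1 where w1: "w1 \<in># L1" by blast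
    have w1b: "w1 \<in> ball 0 1" using w1 L1(2) by blast
    have "B1 w1 = 0" using blaschke_prod_zero_iff[OF L1(2), of w1] w1 w1b by (auto simp: B1')
    hence g1: "?g w1 \<noteq> 0" by simp
    have "zorder ?g w \<ge> int (count (Lr s) w)" if w: "w \<in># Lr s" for w
    proof -
      have w': "w \<in># L0" "of_real (s * a\<^sup>2) * B1 w * B2 w = 1" using w by (auto simp: Lr_def)
      from w'(1) have "w \<in> (\<Union>j\<in>{1..d}. \<Delta> j)" unfolding zeros .
      then obtain j where j: "j \<in> {1..d}" "w \<in> \<Delta> j" by blast
      have sj: "s = t j" using crit_iff[OF j] w'(2) by blast
      have "zorder ?g w \<ge> zorder B0 w" using vanish j unfolding sj by blast
      moreover have "zorder B0 w = int (count L0 w)" using ord w'(1) L0(2) by blast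
      moreover have "count (Lr s) w \<le> count L0 w" by (simp add: Lr_def)
      ultimately show ?thesis by linarith
    qed
    then obtain H where H: "H analytic_on cball 0 1" "\<forall>z\<in>cball 0 1. ?g z = blaschke_prod (Lr s) z * H z"
      using divide_by_blaschke_prod[OF Lr_ball ga w1b g1] by blast
    have H': "H w \<noteq> 0" if "w \<in># ?L'" for w
    proof
      assume "H w = 0"
      moreover have "w \<in> cball 0 1" using that L0(2) by auto
      ultimately have "?g w = 0" using H(2) by simp
      thus False using that by simp
    qed
    \<comment> \<open>On taking moduli, equality would give \<open>t j * s = 1\<close>.\<close>
    have reflected: "of_real (a\<^sup>2) * cnj (blaschke_prod L1 w * blaschke_prod L2 w) \<noteq> of_real s * c1 * c2"
      if w: "w \<in># L0" for w
    proof
      assume eq: "of_real (a\<^sup>2) * cnj (blaschke_prod L1 w * blaschke_prod L2 w) = of_real s * c1 * c2"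
      obtain j where j: "j \<in> {1..d}" "of_real (t j * a\<^sup>2) * B1 w * B2 w = 1" using crit[OF w] by blast
      define m where "m = cmod (blaschke_prod L1 w * blaschke_prod L2 w)"
      have "cmod (of_real (t j * a\<^sup>2) * B1 w * B2 w) = \<bar>t j * a\<^sup>2\<bar> * m"
        by (simp only: B1' B2' norm_mult norm_of_real c1 c2 m_def mult_1_left mult.assoc)
      moreover have "t j > 0" using t_range j(1) by auto
      ultimately have 1: "t j * a\<^sup>2 * m = 1" unfolding j(2) by simp
      have "cmod (of_real (a\<^sup>2) * cnj (blaschke_prod L1 w * blaschke_prod L2 w)) = a\<^sup>2 * m"
        by (simp only: norm_mult norm_of_real complex_mod_cnj m_def abs_power2)
      moreover have "cmod (of_real s * c1 * c2) = s" using s c1 c2 by (simp add: norm_mult)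
      ultimately have "a\<^sup>2 * m = s" using eq by simp
      hence "t j * s = 1" using 1 by (simp add: mult.assoc)
      moreover have "t j > 0" "t j < 1" using t_range j(1) by auto
      moreover have "t j * s \<le> t j * 1" using \<open>t j > 0\<close> s by (intro mult_left_mono) auto
      ultimately show False by simp
    qed
    have ne: "L0 \<noteq> {#}" using L0(1) k by auto
    have "s \<noteq> 0" using s by simp
    have Hz: "1 - of_real (s * a\<^sup>2) * (c1 * blaschke_prod L1 z) * (c2 * blaschke_prod L2 z)
        = blaschke_prod (Lr s) z * H z"
      if "z \<in> cball 0 1" for z
      using H(2) that unfolding B1' B2' by blast
    note main = degrees_Psi[OF c L0(2) L1(2) L2(2) \<open>s \<noteq> 0\<close> split H(1) Hz H' ne reflected, folded B0' B1' B2']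
    have "size ?L' = k - 1 - size (Lr s)" using arg_cong[OF split, of size] L0(1) by simp
    thus "deg_minus (Psi B0 B1 B2 a s) = (k - 1 - size (Lr s)) + k" "deg_plus (Psi B0 B1 B2 a s) = (k - 1) + (k - 2)"
      using main L0(1) L1(1) L2(1) by simp_all
  qed
  have Lr_empty: "Lr s = {#}" if "s \<notin> t ` {1..d}" for s
  proof -
    have "of_real (s * a\<^sup>2) * B1 w * B2 w \<noteq> 1" if "w \<in># L0" for w
      using crit[OF that] crit_iff \<open>s \<notin> t ` {1..d}\<close> by blast
    thus ?thesis unfolding Lr_def by (auto simp: filter_mset_eq_conv)
  qed
  have Lr_size: "int (size (Lr (t j))) = \<kappa> j" "size (Lr (t j)) > 0" "size (Lr (t j)) \<le> k - 1"
    if j: "j \<in> {1..d}" for j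
  proof -
    have \<Delta>_L0: "\<Delta> j \<subseteq> set_mset L0" using zeros j by blast
    have "w \<in># Lr (t j) \<longleftrightarrow> w \<in> \<Delta> j" for w
    proof
      assume w: "w \<in># Lr (t j)"
      hence "w \<in> (\<Union>j\<in>{1..d}. \<Delta> j)" unfolding zeros by (simp add: Lr_def)
      then obtain i where i: "i \<in> {1..d}" "w \<in> \<Delta> i" by blast
      have "t j = t i" using crit_iff[OF i] w by (simp add: Lr_def)
      thus "w \<in> \<Delta> j" using t_distinct i j by (metis inj_onD)
    next
      assume w: "w \<in> \<Delta> j"
      thus "w \<in># Lr (t j)" using crit_iff[OF j w] \<Delta>_L0 by (auto simp: Lr_def)
    qed
    hence set: "set_mset (Lr (t j)) = \<Delta> j" by blast
    have "count (Lr (t j)) w = count L0 w" if "w \<in> \<Delta> j" for w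
      using crit_iff[OF j that] by (simp add: Lr_def)
    hence "size (Lr (t j)) = (\<Sum>w\<in>\<Delta> j. count L0 w)"
      unfolding size_multiset_overloaded_eq set by (intro sum.cong) auto
    hence "int (size (Lr (t j))) = (\<Sum>w\<in>\<Delta> j. zorder B0 w)"
      using ord \<Delta>_L0 L0(2) by (simp add: subset_iff)
    thus "int (size (Lr (t j))) = \<kappa> j" using \<kappa> j by simp
    show "size (Lr (t j)) > 0" using set \<Delta>_nonempty j by (metis nonempty_has_size set_mset_eq_empty_iff)
    have "size (Lr (t j)) \<le> size L0" unfolding Lr_def by (rule size_filter_mset_lesseq)
    thus "size (Lr (t j)) \<le> k - 1" using L0(1) by simp
  qed
  have t1: "t j \<in> {0<..1}" if "j \<in> {1..d}" for j
    using t_range that by (metis greaterThanAtMost_iff greaterThanLessThan_iff less_imp_le)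
  show ?thesis
  proof (intro conjI ballI)
    fix s :: real assume s: "s \<in> {0<..1}"
    show "\<not> int (deg_plus (Psi B0 B1 B2 a s)) \<le> int (deg_minus (Psi B0 B1 B2 a s)) - 2 \<longleftrightarrow> s \<in> t ` {1..d}"
    proof (cases "s \<in> t ` {1..d}")
      case True
      then obtain j where j: "j \<in> {1..d}" "s = t j" by blast
      thus ?thesis using True degs[OF s] Lr_size[OF j(1)] k by simp
    next
      case False
      thus ?thesis using degs[OF s] Lr_empty[OF False] k by simp
    qed
  next
    fix j assume j: "j \<in> {1..d}"
    show "int (deg_plus (Psi B0 B1 B2 a (t j))) = int (deg_minus (Psi B0 B1 B2 a (t j))) - 2 + \<kappa> j"
      using degs[OF t1[OF j]] Lr_size[OF j] k by simp
  qed
qed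

end
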